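(* Let $T=(n_1,\dots,n_r)$ be a 2-type vector, $n_1<\cdots<n_r$, and let $T'=(m_1,\dots,m_{2r})$ be its associated pseudo type vector. Let $\mathbb X$ be the spread out linear configuration of type $T$ and let $\mathbb Z$ be its first infinitesimal neighborhood. Then: (i) $\mathbb Z$ can be obtained from the empty scheme by a finite sequence of basic double links; (ii) the first difference of the Hilbert function of $\mathbb Z$ is the standard O-sequence associated to $T'$; (iii) the regularity of $\mathbb Z$ is $m_{2r}=2n_r$.
   Context: Work over an infinite field $k$ of characteristic zero, $R=k[x_0,x_1,x_2]$. A 2-type vector is $(n_1,\dots,n_r)$ with integers $0<n_1<\cdots<n_r$. The spread out linear configuration of type $T$ consists, for each $i=1,\dots,r$, of the $n_i$ points $[j:n_r-n_i:1]$, $0\le j\le n_i-1$. The associated pseudo type vector is $T'=(n_1,2n_1,n_2,2n_2,\dots,n_r,2n_r)$ reordered in non-decreasing order, written $(m_1,\dots,m_{2r})$. The first infinitesimal neighborhood of a reduced point set $\{P_1,\dots,P_s\}$ with prime ideals $\wp_i$ is the scheme defined by $\wp_1^2\cap\cdots\cap\wp_s^2$. Hilbert function $h(t)=\dim_k(R/I)_t$, first difference $\Delta h(t)=h(t)-h(t-1)$, regularity = least $t$ with $\Delta h(t)=0$. Standard O-sequence of a sequence $(m_1,\dots,m_p)$ with $m_1\le\cdots\le m_p$: set $m_0=0,m_{p+1}=\infty$. If $m_{i-1}<m_i<m_{i+1}$, $(s_i)_t=1$ for $0\le t\le m_i-1$, $0$ otherwise; if $m_{i-1}=m_i<m_{i+1}$,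 $(s_i)_0=1$, $(s_i)_t=2$ for $1\le t\le m_i-1$, $(s_i)_{m_i}=1$, $0$ otherwise; if $m_{i-1}<m_i=m_{i+1}$, $s_i$ is undefined. The standard O-sequence is $\sum_i s_i(i-p)$ over defined $s_i$, where $s(-k)_t=s_{t-k}$. Basic double link: for a zero-dimensional scheme $\mathbb Y$ (or empty, ideal $R$), forms $F\in I_{\mathbb Y}$ and $G$ forming a regular sequence, the saturated ideal $G\cdot I_{\mathbb Y}+(F)$ defines a basic double link of $\mathbb Y$. *)

theory Defs
  imports "HOL-Library.Poly_Mapping"
begin

datatype var = X0 | X1 | X2

type_synonym monom = "var \<Rightarrow>\<^sub>0 nat"
type_synonym 'k mpoly3 = "monom \<Rightarrow>\<^sub>0 'k"

definition mdeg :: "monom \<Rightarrow> nat" where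
  "mdeg m = Poly_Mapping.lookup m X0 + Poly_Mapping.lookup m X1 + Poly_Mapping.lookup m X2"

text \<open>f is a form (homogeneous polynomial) of degree d (0 counts as a form of every degree).\<close>
definition homog :: "nat \<Rightarrow> 'k::zero mpoly3 \<Rightarrow> bool" where
  "homog d f \<longleftrightarrow> (\<forall>m\<in>Poly_Mapping.keys f. mdeg m = d)"

definition is_form :: "'k::zero mpoly3 \<Rightarrow> bool" where
  "is_form f \<longleftrightarrow> (\<exists>d. homog d f)"

definition const :: "'k::zero \<Rightarrow> 'k mpoly3" where
  "const c = Poly_Mapping.single 0 c"

text \<open>Evaluation at an affine representative (a0,a1,a2) of a point of P^2.\<close>
definition eval3 :: "'k::comm_semiring_1 mpoly3 \<Rightarrow> 'k \<times> 'k \<times> 'k \<Rightarrow> 'k" where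
  "eval3 f P = (case P of (a0, a1, a2) \<Rightarrow>
     (\<Sum>m\<in>Poly_Mapping.keys f. Poly_Mapping.lookup f m * a0 ^ Poly_Mapping.lookup m X0 * a1 ^ Poly_Mapping.lookup m X1 * a2 ^ Poly_Mapping.lookup m X2))"

definition is_ideal :: "'k::comm_ring_1 mpoly3 set \<Rightarrow> bool" where
  "is_ideal I \<longleftrightarrow> 0 \<in> I \<and> (\<forall>a\<in>I. \<forall>b\<in>I. a + b \<in> I) \<and> (\<forall>a\<in>I. \<forall>r. r * a \<in> I)"

definition ideal_gen :: "'k::comm_ring_1 mpoly3 set \<Rightarrow> 'k mpoly3 set" where
  "ideal_gen S = \<Inter> {I. is_ideal I \<and> S \<subseteq> I}"

definition ideal_prod :: "'k::comm_ring_1 mpoly3 set \<Rightarrow> 'k mpoly3 set \<Rightarrow> 'k mpoly3 set" where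
  "ideal_prod I J = ideal_gen {a * b | a b. a \<in> I \<and> b \<in> J}"

definition point_ideal :: "'k::comm_ring_1 \<times> 'k \<times> 'k \<Rightarrow> 'k mpoly3 set" where
  "point_ideal P = ideal_gen {f. is_form f \<and> eval3 f P = 0}"

definition first_inf_nbhd_ideal :: "('k::comm_ring_1 \<times> 'k \<times> 'k) set \<Rightarrow> 'k mpoly3 set" where
  "first_inf_nbhd_ideal X = \<Inter> ((\<lambda>P. ideal_prod (point_ideal P) (point_ideal P)) ` X)"

text \<open>h(t) = dim_k (R/I)_t: the maximal number of degree-t forms that are
  k-linearly independent modulo I.\<close>
definition hilb :: "'k::field mpoly3 set \<Rightarrow> nat \<Rightarrow> nat" where
  "hilb I t = (GREATEST n. \<exists>f :: nat \<Rightarrow> 'k mpoly3. (\<forall>i<n. homog t (f i)) \<and>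
      (\<forall>c :: nat \<Rightarrow> 'k. (\<Sum>i<n. const (c i) * f i) \<in> I \<longrightarrow> (\<forall>i<n. c i = 0)))"

definition dhilb :: "'k::field mpoly3 set \<Rightarrow> nat \<Rightarrow> int" where
  "dhilb I t = (if t = 0 then int (hilb I 0) else int (hilb I t) - int (hilb I (t - 1)))"

definition regularity :: "'k::field mpoly3 set \<Rightarrow> nat" where
  "regularity I = (LEAST t. dhilb I t = 0)"

definition regular_seq2 :: "'k::comm_ring_1 mpoly3 \<Rightarrow> 'k mpoly3 \<Rightarrow> bool" where
  "regular_seq2 F G \<longleftrightarrow> ideal_gen {F, G} \<noteq> UNIV
     \<and> (\<forall>h. F * h = 0 \<longrightarrow> h = 0)
     \<and> (\<forall>h. G * h \<in> ideal_gen {F} \<longrightarrow> h \<in> ideal_gen {F})"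

definition basic_double_link :: "'k::comm_ring_1 mpoly3 set \<Rightarrow> 'k mpoly3 set \<Rightarrow> bool" where
  "basic_double_link I J \<longleftrightarrow> (\<exists>F G. is_form F \<and> is_form G \<and> F \<in> I \<and> regular_seq2 F G \<and>
      J = {G * a + F * b | a b. a \<in> I})"

text \<open>The scheme with ideal J is obtained from the empty scheme (ideal R) by a finite
  sequence of basic double links.\<close>
definition obtained_by_bdl :: "'k::comm_ring_1 mpoly3 set \<Rightarrow> bool" where
  "obtained_by_bdl J \<longleftrightarrow> (\<exists>Is. Is \<noteq> [] \<and> hd Is = UNIV \<and> last Is = J \<and>
      (\<forall>i. Suc i < length Is \<longrightarrow> basic_double_link (Is ! i) (Is ! Suc i)))"

definition two_type_vector :: "nat list \<Rightarrow> bool" where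
  "two_type_vector T \<longleftrightarrow> T \<noteq> [] \<and> sorted_wrt (<) T \<and> (\<forall>n\<in>set T. 0 < n)"

definition pseudo_type_vector :: "nat list \<Rightarrow> nat list" where
  "pseudo_type_vector T = sort (T @ map (\<lambda>n. 2 * n) T)"

definition spread_out_config :: "nat list \<Rightarrow> ('k::comm_ring_1 \<times> 'k \<times> 'k) set" where
  "spread_out_config T = {(of_nat j, of_nat (last T - n), 1) | n j. n \<in> set T \<and> j < n}"

text \<open>The sequence s_i (1-based index i) for a sequence ms = (m_1,...,m_p), at integer t;
  undefined s_i contribute nothing.\<close>
definition std_piece :: "nat list \<Rightarrow> nat \<Rightarrow> int \<Rightarrow> int" where
  "std_piece ms i t =
    (let p = length ms; mi = int (ms ! (i - 1));
         prev = (if i = 1 then 0 else int (ms ! (i - 2)));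
         lt_next = (i = p \<or> ms ! (i - 1) < ms ! i)
     in if prev < mi \<and> lt_next then (if 0 \<le> t \<and> t \<le> mi - 1 then 1 else 0)
        else if prev = mi \<and> lt_next then
          (if t = 0 then 1 else if 1 \<le> t \<and> t \<le> mi - 1 then 2 else if t = mi then 1 else 0)
        else 0)"

text \<open>Standard O-sequence: sum of s_i(i-p), where s(-k)_t = s_(t-k).\<close>
definition std_O_seq :: "nat list \<Rightarrow> nat \<Rightarrow> int" where
  "std_O_seq ms t = (\<Sum>i\<in>{1..length ms}. std_piece ms i (int t - int (length ms - i)))"

end

theory Submission
  imports Defs "HOL-Library.Multiset"
begin

text \<open>Order the rows with multiplicities \<open>(e, n)\<close>, \<open>e \<in> {1, 2}\<close>, \<open>n\<close> in \<open>T\<close>, by the value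
  \<open>m = e * n\<close> and add them one at a time. If \<open>I\<close> is the ideal of the scheme built so far, the next
  ideal is \<open>L \<cdot> I + (F)\<close>, where \<open>L\<close> is the line of the row and \<open>F\<close> is a product of
  \<open>\<lfloor>m / 2\<rfloor>\<close> vertical lines \<open>x = j z\<close> and \<open>\<lceil>m / 2\<rceil>\<close> diagonals \<open>x + y = c z\<close>. Since the configuration
  is spread out, every row \<open>(e', n')\<close> with \<open>e' n' \<le> m\<close> lies on \<open>F\<close> with multiplicity \<open>e'\<close>, and \<open>F\<close>
  cuts out on \<open>L\<close> exactly the \<open>n\<close> points of the row with multiplicity \<open>e\<close>. Such a link shifts the
  first difference of the Hilbert function by one and adds the block \<open>1, \<dots>, 1\<close> of length \<open>m\<close>; the
  standard O-sequence is the sum of these blocks.\<close>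

section \<open>Polynomials in three variables\<close>

text \<open>The order on \<open>var\<close> makes the monomials a linearly ordered cancellative monoid, so that polynomials
  over a field become an instance of \<open>idom\<close>.\<close>

instantiation var :: linorder
begin

definition "less_eq_var (a::var) b \<longleftrightarrow> a = b \<or> a = X0 \<or> b = X2"
definition "less_var (a::var) b \<longleftrightarrow> a \<noteq> b \<and> (a = X0 \<or> b = X2)"

instance
  by standard (auto simp: less_eq_var_def less_var_def intro: var.exhaust)

end

definition pvar :: "var \<Rightarrow> 'k::comm_ring_1 mpoly3" where
  "pvar v = Poly_Mapping.single (Poly_Mapping.single v 1) 1"

abbreviation (input) "px \<equiv> pvar X0"
abbreviation (input) "py \<equiv> pvar X1"
abbreviation (input) "pz \<equiv> pvar X2"

lemma const_simps [simp]:
  "const 0 = (0 :: 'k::comm_ring_1 mpoly3)" "const 1 = (1 :: 'k mpoly3)"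
  "const (a + b) = (const a + const b :: 'k mpoly3)"
  "const (a - b) = (const a - const b :: 'k mpoly3)"
  "const (- a) = (- const a :: 'k mpoly3)"
  "const (a * b) = (const a * const b :: 'k mpoly3)"
  by (simp_all add: const_def single_add single_diff single_uminus mult_single)

lemma const_eq_0_iff [simp]: "const c = 0 \<longleftrightarrow> c = 0"
  by (simp add: const_def) (metis lookup_single_eq lookup_zero single_zero)

lemma const_sum: "const (\<Sum>i\<in>A. f i) = (\<Sum>i\<in>A. const (f i) :: 'k::comm_ring_1 mpoly3)"
  by (induction A rule: infinite_finite_induct) auto

lemma pvar_power: "pvar v ^ n = (Poly_Mapping.single (Poly_Mapping.single v n) 1 :: 'k::comm_ring_1 mpoly3)"
  by (induction n) (auto simp: pvar_def mult_single single_add[symmetric])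

lemma pvar_neq_0 [simp]: "pvar v \<noteq> (0 :: 'k::comm_ring_1 mpoly3)"
  by (metis lookup_single_eq lookup_zero one_neq_zero pvar_def)

lemma monom_eq_single_sum:
  "m = Poly_Mapping.single X0 (Poly_Mapping.lookup m X0) + Poly_Mapping.single X1 (Poly_Mapping.lookup m X1)
     + Poly_Mapping.single X2 (Poly_Mapping.lookup m X2)"
proof (rule poly_mapping_eqI)
  fix v show "Poly_Mapping.lookup m v = Poly_Mapping.lookup (Poly_Mapping.single X0 (Poly_Mapping.lookup m X0) + Poly_Mapping.single X1 (Poly_Mapping.lookup m X1)
     + Poly_Mapping.single X2 (Poly_Mapping.lookup m X2)) v"
    by (cases v) (auto simp: lookup_add lookup_single)
qed

section \<open>Monomial values and substitution endomorphisms\<close>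

definition mon_val :: "'k::comm_ring_1 mpoly3 \<Rightarrow> 'k mpoly3 \<Rightarrow> 'k mpoly3 \<Rightarrow> monom \<Rightarrow> 'k mpoly3" where
  "mon_val A B C m = A ^ Poly_Mapping.lookup m X0 * B ^ Poly_Mapping.lookup m X1 * C ^ Poly_Mapping.lookup m X2"

lemma mon_val_0 [simp]: "mon_val A B C 0 = 1"
  by (simp add: mon_val_def)

lemma mon_val_add: "mon_val A B C (m + n) = mon_val A B C m * mon_val A B C n"
  by (simp add: mon_val_def lookup_add power_add ac_simps)

lemma single_eq_mon_val: "Poly_Mapping.single m c = const c * mon_val px py pz m"
  by (subst monom_eq_single_sum) (simp add: mon_val_def pvar_power const_def mult_single)

lemma sum_single_lookup:
  fixes f :: "'a \<Rightarrow>\<^sub>0 'b::comm_monoid_add"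
  shows "f = (\<Sum>m\<in>Poly_Mapping.keys f. Poly_Mapping.single m (Poly_Mapping.lookup f m))"
proof (rule poly_mapping_eqI)
  fix k
  have "(\<Sum>m\<in>Poly_Mapping.keys f. Poly_Mapping.lookup (Poly_Mapping.single m (Poly_Mapping.lookup f m)) k)
      = (\<Sum>m\<in>Poly_Mapping.keys f. if m = k then Poly_Mapping.lookup f k else 0)"
    by (intro sum.cong) (auto simp: lookup_single)
  also have "\<dots> = Poly_Mapping.lookup f k"
    by (auto simp: not_in_keys_iff_lookup_eq_zero)
  finally show "Poly_Mapping.lookup f k = Poly_Mapping.lookup (\<Sum>m\<in>Poly_Mapping.keys f. Poly_Mapping.single m (Poly_Mapping.lookup f m)) k"
    by (simp add: lookup_sum)
qed

text \<open>Constants and variables generate the polynomial ring under sums and products.\<close>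

lemma mpoly3_induct [case_names const pvar add mult]:
  fixes f :: "'k::comm_ring_1 mpoly3"
  assumes const: "\<And>c. P (const c)" and pvar: "\<And>v. P (pvar v)"
    and add: "\<And>f g. P f \<Longrightarrow> P g \<Longrightarrow> P (f + g)" and mult: "\<And>f g. P f \<Longrightarrow> P g \<Longrightarrow> P (f * g)"
  shows "P f"
proof -
  have pow: "P (pvar v ^ n)" for v n
    by (induction n) (use const[of 1] in \<open>auto intro: mult pvar\<close>)
  have single: "P (Poly_Mapping.single m c)" for m c
    unfolding single_eq_mon_val mon_val_def by (intro mult const pow)
  have "P (\<Sum>m\<in>A. Poly_Mapping.single m (Poly_Mapping.lookup f m))" if "finite A" for A
    using that by induction (use const[of 0] in \<open>auto intro: add single\<close>)
  from this[of "Poly_Mapping.keys f"] show ?thesis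
    using sum_single_lookup[of f] by simp
qed

text \<open>Evaluation at a point, restriction to a line and passage to the constant term are all
  instances of this endomorphism, so their kernels are treated uniformly.\<close>

definition psubst :: "'k::comm_ring_1 mpoly3 \<Rightarrow> 'k mpoly3 \<Rightarrow> 'k mpoly3 \<Rightarrow> 'k mpoly3 \<Rightarrow> 'k mpoly3" where
  "psubst A B C f = (\<Sum>m\<in>Poly_Mapping.keys f. const (Poly_Mapping.lookup f m) * mon_val A B C m)"

lemma psubst_single: "psubst A B C (Poly_Mapping.single m c) = const c * mon_val A B C m"
  by (simp add: psubst_def)

lemma psubst_add [simp]: "psubst A B C (f + g) = psubst A B C f + psubst A B C g"
  unfolding psubst_def by (rule setsum_keys_plus_distrib) (simp_all add: algebra_simps)

lemma psubst_0 [simp]: "psubst A B C 0 = 0"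
  by (simp add: psubst_def)

lemma psubst_sum [simp]: "psubst A B C (\<Sum>i\<in>I. f i) = (\<Sum>i\<in>I. psubst A B C (f i))"
  by (induction I rule: infinite_finite_induct) auto

lemma psubst_const [simp]: "psubst A B C (const c) = const c"
  unfolding const_def[of c] psubst_single by (simp add: const_def)

lemma psubst_1 [simp]: "psubst A B C 1 = 1"
  using psubst_const[of A B C 1] by (simp del: psubst_const)

lemma psubst_pvar [simp]: "psubst A B C (pvar v) = (case v of X0 \<Rightarrow> A | X1 \<Rightarrow> B | X2 \<Rightarrow> C)"
  unfolding pvar_def psubst_single by (cases v) (auto simp: mon_val_def lookup_single)

lemma psubst_mult [simp]: "psubst A B C (f * g) = psubst A B C f * psubst A B C g"
proof -
  have "f * g = (\<Sum>m\<in>Poly_Mapping.keys f. \<Sum>n\<in>Poly_Mapping.keys g.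
      Poly_Mapping.single (m + n) (Poly_Mapping.lookup f m * Poly_Mapping.lookup g n))"
    by (subst sum_single_lookup[of f], subst sum_single_lookup[of g]) (simp add: sum_product mult_single)
  then have "psubst A B C (f * g) = (\<Sum>m\<in>Poly_Mapping.keys f. \<Sum>n\<in>Poly_Mapping.keys g.
      const (Poly_Mapping.lookup f m) * mon_val A B C m * (const (Poly_Mapping.lookup g n) * mon_val A B C n))"
    by (simp add: psubst_single mon_val_add ac_simps)
  also have "\<dots> = psubst A B C f * psubst A B C g"
    by (simp add: psubst_def sum_product)
  finally show ?thesis .
qed

lemma psubst_uminus [simp]: "psubst A B C (- f) = - psubst A B C f"
  using psubst_add[of A B C f "- f"] by (simp add: eq_neg_iff_add_eq_0 del: psubst_add) (simp add: add.commute)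

lemma psubst_diff [simp]: "psubst A B C (f - g) = psubst A B C f - psubst A B C g"
  using psubst_add[of A B C f "- g"] by (simp del: psubst_add)

lemma psubst_power [simp]: "psubst A B C (f ^ n) = psubst A B C f ^ n"
  by (induction n) auto

lemma psubst_prod [simp]: "psubst A B C (\<Prod>i\<in>I. f i) = (\<Prod>i\<in>I. psubst A B C (f i))"
  by (induction I rule: infinite_finite_induct) auto

section \<open>Ideals\<close>

lemma is_idealD:
  assumes "is_ideal I"
  shows "0 \<in> I" "a \<in> I \<Longrightarrow> b \<in> I \<Longrightarrow> a + b \<in> I" "a \<in> I \<Longrightarrow> r * a \<in> I" "a \<in> I \<Longrightarrow> a * r \<in> I"
    "a \<in> I \<Longrightarrow> - a \<in> I" "a \<in> I \<Longrightarrow> b \<in> I \<Longrightarrow> a - b \<in> I"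
proof -
  show *: "0 \<in> I" "a \<in> I \<Longrightarrow> b \<in> I \<Longrightarrow> a + b \<in> I" "\<And>a r. a \<in> I \<Longrightarrow> r * a \<in> I" for a b
    using assms by (auto simp: is_ideal_def)
  show "a \<in> I \<Longrightarrow> a * r \<in> I" using *(3)[of a r] by (simp add: mult.commute)
  show neg: "b \<in> I \<Longrightarrow> - b \<in> I" for b using *(3)[of b "- 1"] by simp
  show "a \<in> I \<Longrightarrow> b \<in> I \<Longrightarrow> a - b \<in> I" using *(2)[of a "- b"] neg[of b] by simp
qed

lemma is_ideal_sum: "is_ideal I \<Longrightarrow> (\<And>i. i \<in> A \<Longrightarrow> f i \<in> I) \<Longrightarrow> (\<Sum>i\<in>A. f i) \<in> I"
  by (induction A rule: infinite_finite_induct) (auto intro: is_idealD)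

lemma is_ideal_UNIV: "is_ideal UNIV"
  by (simp add: is_ideal_def)

lemma is_ideal_INT: "(\<And>i. i \<in> A \<Longrightarrow> is_ideal (I i)) \<Longrightarrow> is_ideal (\<Inter>i\<in>A. I i)"
  by (auto simp: is_ideal_def)

lemma is_ideal_principal: "is_ideal {f. D dvd f}"
  by (auto simp: is_ideal_def)

lemma is_ideal_ideal_gen: "is_ideal (ideal_gen S)"
  unfolding ideal_gen_def by (auto simp: is_ideal_def)

lemma ideal_gen_superset: "S \<subseteq> ideal_gen S"
  by (auto simp: ideal_gen_def)

lemma ideal_gen_minimal: "is_ideal I \<Longrightarrow> S \<subseteq> I \<Longrightarrow> ideal_gen S \<subseteq> I"
  by (auto simp: ideal_gen_def)

lemma ideal_gen_singleton: "ideal_gen {F} = {f. F dvd f}"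
proof
  show "ideal_gen {F} \<subseteq> {f. F dvd f}"
    by (rule ideal_gen_minimal) (auto simp: is_ideal_principal)
  show "{f. F dvd f} \<subseteq> ideal_gen {F}"
    using ideal_gen_superset[of "{F}"] is_idealD(4)[OF is_ideal_ideal_gen[of "{F}"]] by (auto elim!: dvdE)
qed

text \<open>Modulo \<open>I\<close> the endomorphism agrees with the identity on the variables,
  hence everywhere. For \<open>I\<close> generated by the three differences this shows that they
  generate the kernel of the substitution whenever they lie in it.\<close>

lemma diff_psubst_in_ideal:
  assumes I: "is_ideal I" and "px - A \<in> I" "py - B \<in> I" "pz - C \<in> I"
  shows "f - psubst A B C f \<in> I"
proof (induction f rule: mpoly3_induct)
  case (const c)
  show ?case using is_idealD(1)[OF I] by simp
next
  case (pvar v)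
  show ?case using assms by (cases v) auto
next
  case (add f g)
  have "f + g - psubst A B C (f + g) = (f - psubst A B C f) + (g - psubst A B C g)" by simp
  then show ?case using is_idealD(2)[OF I] add by metis
next
  case (mult f g)
  have "f * g - psubst A B C (f * g) = g * (f - psubst A B C f) + psubst A B C f * (g - psubst A B C g)"
    by (simp add: algebra_simps)
  then show ?case using is_idealD[OF I] mult by metis
qed

section \<open>Homogeneous polynomials\<close>

lemma homog_0 [simp]: "homog d 0"
  by (simp add: homog_def)

lemma homog_single: "mdeg m = d \<Longrightarrow> homog d (Poly_Mapping.single m c)"
  by (auto simp: homog_def)

lemma homog_add: "homog d f \<Longrightarrow> homog d g \<Longrightarrow> homog d (f + g)"
  using keys_add[of f g] by (auto simp: homog_def)

lemma homog_uminus: "homog d f \<Longrightarrow> homog d (- f :: 'k::comm_ring_1 mpoly3)"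
  by (auto simp: homog_def in_keys_iff)

lemma homog_diff: "homog d f \<Longrightarrow> homog d g \<Longrightarrow> homog d (f - g :: 'k::comm_ring_1 mpoly3)"
  using homog_add[of d f "- g"] homog_uminus[of d g] by simp

lemma homog_mult:
  fixes f g :: "'k::comm_ring_1 mpoly3"
  shows "homog d f \<Longrightarrow> homog e g \<Longrightarrow> homog (d + e) (f * g)"
  using keys_mult[of f g] by (fastforce simp: homog_def mdeg_def lookup_add)

lemma homog_const: "homog 0 (const c)"
  by (auto simp: const_def mdeg_def intro!: homog_single)

lemma homog_1: "homog 0 (1 :: 'k::comm_ring_1 mpoly3)"
  using homog_const[of "1::'k"] by simp

lemma homog_const_mult: "homog d f \<Longrightarrow> homog d (const c * f)" for f :: "'k::comm_ring_1 mpoly3"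
  using homog_mult[OF homog_const] by fastforce

lemma homog_pvar: "homog 1 (pvar v)"
  unfolding pvar_def by (rule homog_single) (cases v; simp add: mdeg_def lookup_single)

lemma homog_prod:
  fixes f :: "nat \<Rightarrow> 'k::comm_ring_1 mpoly3"
  assumes "\<And>i. i < n \<Longrightarrow> homog 1 (f i)"
  shows "homog n (\<Prod>i<n. f i)"
  using assms
proof (induction n)
  case (Suc n)
  then show ?case using homog_mult[of n "\<Prod>i<n. f i" 1 "f n"] by simp
qed (simp add: homog_1)

lemma homog_power: "homog 1 f \<Longrightarrow> homog n (f ^ n)" for f :: "'k::comm_ring_1 mpoly3"
  using homog_prod[of n "\<lambda>_. f"] by simp

text \<open>Every monomial of a form of degree \<open>d\<close> contributes the same power of
  \<open>pz\<close>. On forms this turns the vanishing of \<open>eval3\<close> into the vanishing of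
  a ring homomorphism.\<close>

lemma psubst_homog_eval3:
  fixes f :: "'k::comm_ring_1 mpoly3"
  assumes "homog d f"
  shows "psubst (const a * pz) (const b * pz) (const c * pz) f = const (eval3 f (a, b, c)) * pz ^ d"
proof -
  have const_power: "const (a ^ n) = (const a ^ n :: 'k mpoly3)" for a n
    by (induction n) auto
  have "const (Poly_Mapping.lookup f m) * mon_val (const a * pz) (const b * pz) (const c * pz) m
     = const (Poly_Mapping.lookup f m * a ^ Poly_Mapping.lookup m X0 * b ^ Poly_Mapping.lookup m X1 * c ^ Poly_Mapping.lookup m X2) * pz ^ d"
    if "m \<in> Poly_Mapping.keys f" for m
  proof -
    have "d = Poly_Mapping.lookup m X0 + Poly_Mapping.lookup m X1 + Poly_Mapping.lookup m X2"
      using assms that by (auto simp: homog_def mdeg_def)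
    then show ?thesis
      by (simp add: mon_val_def power_mult_distrib power_add const_power ac_simps)
  qed
  then show ?thesis
    by (simp add: psubst_def eval3_def const_sum sum_distrib_right)
qed

section \<open>Double points\<close>

lemma linear_dvd_iff_0:
  "px - const a * pz dvd f \<longleftrightarrow> psubst (const a * pz) py pz f = 0"
proof
  assume "psubst (const a * pz) py pz f = 0"
  moreover have "f - psubst (const a * pz) py pz f \<in> {f. px - const a * pz dvd f}"
    by (rule diff_psubst_in_ideal) (auto simp: is_ideal_principal)
  ultimately show "px - const a * pz dvd f" by simp
qed (auto elim!: dvdE)

lemma linear_dvd_iff_1:
  "py - const b * pz dvd f \<longleftrightarrow> psubst px (const b * pz) pz f = 0"
proof
  assume "psubst px (const b * pz) pz f = 0"
  moreover have "f - psubst px (const b * pz) pz f \<in> {f. py - const b * pz dvd f}"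
    by (rule diff_psubst_in_ideal) (auto simp: is_ideal_principal)
  ultimately show "py - const b * pz dvd f" by simp
qed (auto elim!: dvdE)

lemma linear_neq_0 [simp]:
  "px \<noteq> (const a * pz :: 'k::comm_ring_1 mpoly3)"
  "py \<noteq> (const b * pz :: 'k::comm_ring_1 mpoly3)"
proof -
  have "psubst 1 1 0 px = (1 :: 'k mpoly3)" "psubst 1 1 0 py = (1 :: 'k mpoly3)"
    "psubst 1 1 0 (const a * pz) = (0 :: 'k mpoly3)" "psubst 1 1 0 (const b * pz) = (0 :: 'k mpoly3)"
    by simp_all
  then show "px \<noteq> (const a * pz :: 'k mpoly3)" "py \<noteq> (const b * pz :: 'k mpoly3)"
    by (metis zero_neq_one)+
qed

text \<open>Evaluation at \<open>[a:b:1]\<close> with values in \<open>k[pz]\<close>, so that the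
  kernel is the homogeneous prime of the projective point and not the maximal ideal of the affine
  point \<open>(a, b, 1)\<close>.\<close>

definition pt_eval :: "'k::comm_ring_1 \<Rightarrow> 'k \<Rightarrow> 'k mpoly3 \<Rightarrow> 'k mpoly3" where
  "pt_eval a b = psubst (const a * pz) (const b * pz) pz"

definition pt_ideal :: "'k::comm_ring_1 \<Rightarrow> 'k \<Rightarrow> 'k mpoly3 set" where
  "pt_ideal a b = {f. pt_eval a b f = 0}"

text \<open>The square of \<open>pt_ideal a b\<close>, spelled out through the products of its two
  linear generators.\<close>

definition dbl_ideal :: "'k::comm_ring_1 \<Rightarrow> 'k \<Rightarrow> 'k mpoly3 set" where
  "dbl_ideal a b = (let u = px - const a * pz; v = py - const b * pz
     in {u * u * f + u * v * g + v * v * h | f g h. True})"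

lemma is_ideal_pt_ideal: "is_ideal (pt_ideal a b)"
  by (simp add: is_ideal_def pt_ideal_def pt_eval_def)

lemma pt_idealI: "(px - const a * pz) * f + (py - const b * pz) * g \<in> pt_ideal a b"
  by (simp add: pt_ideal_def pt_eval_def)

lemma pt_idealE:
  assumes "f \<in> pt_ideal a b"
  obtains g h where "f = (px - const a * pz) * g + (py - const b * pz) * h"
proof -
  let ?I = "{(px - const a * pz) * g + (py - const b * pz) * h | g h. True}"
  have I: "is_ideal ?I"
  proof -
    have "0 \<in> ?I" by (auto intro!: exI[of _ 0])
    moreover have "p + q \<in> ?I" if "p \<in> ?I" "q \<in> ?I" for p q
    proof -
      from that obtain g h g' h' where pq: "p = (px - const a * pz) * g + (py - const b * pz) * h"
        "q = (px - const a * pz) * g' + (py - const b * pz) * h'" by blast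
      have "p + q = (px - const a * pz) * (g + g') + (py - const b * pz) * (h + h')"
        unfolding pq by (simp only: distrib_left distrib_right ac_simps)
      then show ?thesis by blast
    qed
    moreover have "r * p \<in> ?I" if "p \<in> ?I" for p r
    proof -
      from that obtain g h where p: "p = (px - const a * pz) * g + (py - const b * pz) * h" by blast
      have "r * p = (px - const a * pz) * (r * g) + (py - const b * pz) * (r * h)"
        unfolding p by (simp only: distrib_left distrib_right ac_simps)
      then show ?thesis by blast
    qed
    ultimately show ?thesis by (simp add: is_ideal_def)
  qed
  have "px - const a * pz = (px - const a * pz) * 1 + (py - const b * pz) * 0"
    "py - const b * pz = (px - const a * pz) * 0 + (py - const b * pz) * 1" by simp_all
  then have "px - const a * pz \<in> ?I" "py - const b * pz \<in> ?I" by blast+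
  moreover have "pz - pz \<in> ?I" using is_idealD(1)[OF I] by (simp only: diff_self)
  ultimately have "f - pt_eval a b f \<in> ?I"
    unfolding pt_eval_def by (rule diff_psubst_in_ideal[OF I])
  with assms have "f \<in> ?I" by (simp add: pt_ideal_def)
  with that show ?thesis by blast
qed

lemma point_ideal_eq: "point_ideal (a, b, 1) = pt_ideal a b"
proof
  show "point_ideal (a, b, 1) \<subseteq> pt_ideal a b"
    unfolding point_ideal_def
  proof (rule ideal_gen_minimal[OF is_ideal_pt_ideal], clarsimp simp: is_form_def)
    fix f :: "'a mpoly3" and d
    assume "homog d f" "eval3 f (a, b, 1) = 0"
    then show "f \<in> pt_ideal a b"
      using psubst_homog_eval3[of d f a b 1] by (simp add: pt_ideal_def pt_eval_def)
  qed
  \<comment> \<open>Linear forms are enough for the reverse inclusion, since two of them generate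
    \<open>pt_ideal a b\<close>.\<close>
  have *: "homog 1 f \<Longrightarrow> f \<in> pt_ideal a b \<Longrightarrow> f \<in> point_ideal (a, b, 1)" for f
  proof -
    assume f: "homog 1 f" "f \<in> pt_ideal a b"
    then have "const (eval3 f (a, b, 1)) * pz = 0"
      using psubst_homog_eval3[of 1 f a b 1] by (simp add: pt_ideal_def pt_eval_def)
    moreover have "Poly_Mapping.lookup (const c * pz) (Poly_Mapping.single X2 1) = c" for c :: 'a
      by (simp add: const_def pvar_def mult_single)
    ultimately have "eval3 f (a, b, 1) = 0" by (metis lookup_zero)
    then show ?thesis
      unfolding point_ideal_def using f ideal_gen_superset by (force simp: is_form_def)
  qed
  have lin: "px - const a * pz \<in> point_ideal (a, b, 1)" "py - const b * pz \<in> point_ideal (a, b, 1)"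
    by (auto intro!: * homog_diff homog_const_mult homog_pvar simp: pt_ideal_def pt_eval_def)
  show "pt_ideal a b \<subseteq> point_ideal (a, b, 1)"
  proof
    fix f assume "f \<in> pt_ideal a b"
    then obtain g h where "f = (px - const a * pz) * g + (py - const b * pz) * h" by (rule pt_idealE)
    with lin show "f \<in> point_ideal (a, b, 1)"
      unfolding point_ideal_def by (auto intro!: is_idealD[OF is_ideal_ideal_gen])
  qed
qed

lemma dbl_idealI:
  "(px - const a * pz) * (px - const a * pz) * f + (px - const a * pz) * (py - const b * pz) * g
     + (py - const b * pz) * (py - const b * pz) * h \<in> dbl_ideal a b"
  unfolding dbl_ideal_def Let_def by blast

lemma dbl_idealE:
  assumes "f \<in> dbl_ideal a b"
  obtains p q r where "f = (px - const a * pz) * (px - const a * pz) * p + (px - const a * pz) * (py - const b * pz) * q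
     + (py - const b * pz) * (py - const b * pz) * r"
  using assms unfolding dbl_ideal_def Let_def by blast

lemma is_ideal_dbl_ideal: "is_ideal (dbl_ideal a b)"
proof -
  let ?u = "px - const a * pz" and ?v = "py - const b * pz"
  have "0 \<in> dbl_ideal a b" using dbl_idealI[of a 0 b 0 0] by simp
  moreover have "p + q \<in> dbl_ideal a b" if pq: "p \<in> dbl_ideal a b" "q \<in> dbl_ideal a b" for p q
  proof -
    obtain f g h where p: "p = ?u * ?u * f + ?u * ?v * g + ?v * ?v * h" using pq(1) by (rule dbl_idealE)
    obtain f' g' h' where q: "q = ?u * ?u * f' + ?u * ?v * g' + ?v * ?v * h'" using pq(2) by (rule dbl_idealE)
    have "p + q = ?u * ?u * (f + f') + ?u * ?v * (g + g') + ?v * ?v * (h + h')"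
      unfolding p q by (simp only: distrib_left distrib_right ac_simps)
    then show ?thesis using dbl_idealI by metis
  qed
  moreover have "r * p \<in> dbl_ideal a b" if p_in: "p \<in> dbl_ideal a b" for p r
  proof -
    obtain f g h where p: "p = ?u * ?u * f + ?u * ?v * g + ?v * ?v * h" using p_in by (rule dbl_idealE)
    have "r * p = ?u * ?u * (r * f) + ?u * ?v * (r * g) + ?v * ?v * (r * h)"
      unfolding p by (simp only: distrib_left distrib_right ac_simps)
    then show ?thesis using dbl_idealI by metis
  qed
  ultimately show ?thesis by (simp add: is_ideal_def)
qed

lemma pt_ideal_mult:
  assumes "f \<in> pt_ideal a b" "g \<in> pt_ideal a b"
  shows "f * g \<in> dbl_ideal a b"
proof -
  let ?u = "px - const a * pz" and ?v = "py - const b * pz"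
  obtain p q where f: "f = ?u * p + ?v * q" using assms(1) by (rule pt_idealE)
  obtain r s where g: "g = ?u * r + ?v * s" using assms(2) by (rule pt_idealE)
  have "f * g = ?u * ?u * (p * r) + ?u * ?v * (p * s + q * r) + ?v * ?v * (q * s)"
    unfolding f g by (simp only: distrib_left distrib_right ac_simps)
  then show ?thesis using dbl_idealI by metis
qed

lemma dbl_ideal_subset_pt_ideal: "dbl_ideal a b \<subseteq> pt_ideal a b"
  by (auto elim!: dbl_idealE simp: pt_ideal_def pt_eval_def)

lemma linear_in_pt_ideal:
  "px - const a * pz \<in> pt_ideal a b" "py - const b * pz \<in> pt_ideal a b"
  by (simp_all add: pt_ideal_def pt_eval_def)

lemma ideal_prod_pt_ideal: "ideal_prod (pt_ideal a b) (pt_ideal a b) = dbl_ideal a b"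
proof
  show "ideal_prod (pt_ideal a b) (pt_ideal a b) \<subseteq> dbl_ideal a b"
    unfolding ideal_prod_def
    by (rule ideal_gen_minimal[OF is_ideal_dbl_ideal]) (use pt_ideal_mult in blast)
  have *: "f * g \<in> ideal_prod (pt_ideal a b) (pt_ideal a b)" if "f \<in> pt_ideal a b" "g \<in> pt_ideal a b" for f g
    unfolding ideal_prod_def by (rule subsetD[OF ideal_gen_superset]) (use that in blast)
  have I: "is_ideal (ideal_prod (pt_ideal a b) (pt_ideal a b))"
    by (simp add: ideal_prod_def is_ideal_ideal_gen)
  show "dbl_ideal a b \<subseteq> ideal_prod (pt_ideal a b) (pt_ideal a b)"
  proof
    fix f assume "f \<in> dbl_ideal a b"
    then obtain p q r where f: "f = (px - const a * pz) * (px - const a * pz) * p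
      + (px - const a * pz) * (py - const b * pz) * q + (py - const b * pz) * (py - const b * pz) * r"
      by (rule dbl_idealE)
    show "f \<in> ideal_prod (pt_ideal a b) (pt_ideal a b)"
      unfolding f
      by (rule is_idealD(2)[OF I] is_idealD(4)[OF I *[OF linear_in_pt_ideal(1) linear_in_pt_ideal(1)]]
          is_idealD(4)[OF I *[OF linear_in_pt_ideal(1) linear_in_pt_ideal(2)]]
          is_idealD(4)[OF I *[OF linear_in_pt_ideal(2) linear_in_pt_ideal(2)]])+
  qed
qed

lemma pt_ideal_prime:
  fixes f g :: "'k::idom mpoly3"
  shows "f * g \<in> pt_ideal a b \<longleftrightarrow> f \<in> pt_ideal a b \<or> g \<in> pt_ideal a b"
  by (auto simp: pt_ideal_def pt_eval_def)

text \<open>The square of the prime of a point is primary. The linear forms \<open>u\<close> and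
  \<open>v\<close> are a regular sequence, so both coefficients of \<open>g = u p + v q\<close> are
  forced into the prime.\<close>

lemma dbl_ideal_colon:
  fixes f g :: "'k::idom mpoly3"
  assumes fg: "f * g \<in> dbl_ideal a b" and f: "f \<notin> pt_ideal a b"
  shows "g \<in> dbl_ideal a b"
proof -
  let ?u = "px - const a * pz :: 'k mpoly3" and ?v = "py - const b * pz :: 'k mpoly3"
  have "f * g \<in> pt_ideal a b" using fg dbl_ideal_subset_pt_ideal by blast
  then have "g \<in> pt_ideal a b" using f by (simp add: pt_ideal_prime)
  then obtain p q where g: "g = ?u * p + ?v * q" by (rule pt_idealE)
  from fg obtain A B C where eq: "f * g = ?u * ?u * A + ?u * ?v * B + ?v * ?v * C" by (rule dbl_idealE)
  \<comment> \<open>Setting \<open>v = 0\<close> shows that \<open>v\<close> divides the left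
    bracket, setting \<open>u = 0\<close> that \<open>u\<close> divides the right one. This puts
    \<open>f * p\<close> and \<open>f * q\<close> into the prime.\<close>
  have eq': "?u * (f * p - ?u * A - ?v * B) = ?v * (?v * C - f * q)"
    using eq unfolding g by algebra
  have "?u * psubst px (const b * pz) pz (f * p - ?u * A - ?v * B) = 0"
    using arg_cong[OF eq', of "psubst px (const b * pz) pz"] by simp
  then have "psubst px (const b * pz) pz (f * p - ?u * A - ?v * B) = 0" by simp
  then obtain k where "f * p - ?u * A - ?v * B = ?v * k"
    unfolding linear_dvd_iff_1[symmetric] by (rule dvdE)
  then have "f * p = ?u * A + ?v * (B + k)" by algebra
  then have p: "p \<in> pt_ideal a b" using pt_idealI[of a A b "B + k"] f pt_ideal_prime by metis
  have "?v * psubst (const a * pz) py pz (?v * C - f * q) = 0"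
    using arg_cong[OF eq', of "psubst (const a * pz) py pz"] by simp
  then have "psubst (const a * pz) py pz (?v * C - f * q) = 0" by simp
  then obtain k where "?v * C - f * q = ?u * k"
    unfolding linear_dvd_iff_0[symmetric] by (rule dvdE)
  then have "f * q = ?u * (- k) + ?v * C" by algebra
  then have q: "q \<in> pt_ideal a b" using pt_idealI[of a "- k" b C] f pt_ideal_prime by metis
  show ?thesis unfolding g
    by (intro is_idealD(2)[OF is_ideal_dbl_ideal] pt_ideal_mult linear_in_pt_ideal p q)
qed

text \<open>Modulo \<open>v\<close> only the term \<open>u * u * A\<close> survives, so
  \<open>v\<close> divides \<open>A\<close> and cancels from the whole equation.\<close>

lemma dbl_ideal_colon_line:
  fixes g :: "'k::idom mpoly3"
  assumes "(py - const b * pz) * g \<in> dbl_ideal a b"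
  shows "g \<in> pt_ideal a b"
proof -
  let ?u = "px - const a * pz :: 'k mpoly3" and ?v = "py - const b * pz :: 'k mpoly3"
  obtain A B C where eq: "?v * g = ?u * ?u * A + ?u * ?v * B + ?v * ?v * C"
    using assms by (rule dbl_idealE)
  have "?u * ?u * psubst px (const b * pz) pz A = 0"
    using arg_cong[OF eq, of "psubst px (const b * pz) pz"] by simp
  then have "psubst px (const b * pz) pz A = 0" by simp
  then obtain k where "A = ?v * k"
    unfolding linear_dvd_iff_1[symmetric] by (rule dvdE)
  then have "?v * g = ?v * (?u * (?u * k + B) + ?v * C)" using eq by algebra
  then have "g = ?u * (?u * k + B) + ?v * C" by simp
  then show ?thesis using pt_idealI by metis
qed

section \<open>Hilbert functions\<close>

text \<open>Gaussian elimination: a vector with nonzero last coordinate clears that coordinate from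
  the others, which leaves one vector and one coordinate less.\<close>

lemma nontrivial_linear_relation:
  fixes M :: "'a \<Rightarrow> nat \<Rightarrow> 'k::field"
  assumes "finite A" "card A > n"
  shows "\<exists>c. (\<exists>i\<in>A. c i \<noteq> 0) \<and> (\<forall>j<n. (\<Sum>i\<in>A. c i * M i j) = 0)"
  using assms
proof (induction n arbitrary: A M)
  case 0
  then obtain i where "i \<in> A" by fastforce
  then show ?case by (intro exI[of _ "\<lambda>_. 1"]) auto
next
  case (Suc n)
  show ?case
  proof (cases "\<exists>k\<in>A. M k n \<noteq> 0")
    case False
    then have "(\<Sum>i\<in>A. c i * M i n) = 0" for c by (intro sum.neutral) auto
    moreover have "card A > n" using Suc.prems by simp
    ultimately show ?thesis using Suc.IH[OF Suc.prems(1), of M] by (metis less_Suc_eq)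
  next
    case True
    then obtain k where k: "k \<in> A" "M k n \<noteq> 0" by blast
    let ?B = "A - {k}"
    let ?N = "\<lambda>i j. M i j - M i n / M k n * M k j"
    have "card ?B > n" "finite ?B" using Suc.prems k by auto
    from Suc.IH[OF this(2,1), of ?N] obtain c where
      c: "\<exists>i\<in>?B. c i \<noteq> 0" "\<forall>j<n. (\<Sum>i\<in>?B. c i * ?N i j) = 0" by blast
    let ?s = "\<Sum>i\<in>?B. c i * M i n"
    \<comment> \<open>The pivot coefficient is chosen to make the last coordinate vanish; it also
      turns the relation among the reduced vectors into one among the original ones.\<close>
    define d where "d = c(k := - ?s / M k n)"
    have d: "(\<Sum>i\<in>A. d i * M i j) = (\<Sum>i\<in>?B. c i * M i j) - ?s / M k n * M k j" for j
    proof -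
      have "(\<Sum>i\<in>A. d i * M i j) = d k * M k j + (\<Sum>i\<in>?B. d i * M i j)"
        using Suc.prems(1) k(1) by (rule sum.remove)
      also have "(\<Sum>i\<in>?B. d i * M i j) = (\<Sum>i\<in>?B. c i * M i j)"
        by (intro sum.cong) (auto simp: d_def)
      finally show ?thesis by (simp add: d_def)
    qed
    have "(\<Sum>i\<in>?B. c i * ?N i j) = (\<Sum>i\<in>A. d i * M i j)" for j
      unfolding d by (simp add: right_diff_distrib sum_subtractf sum_distrib_right sum_divide_distrib mult.assoc)
    then have "(\<Sum>i\<in>A. d i * M i j) = 0" if "j < n" for j using c(2) that by simp
    moreover have "(\<Sum>i\<in>A. d i * M i n) = 0" unfolding d using k by simp
    moreover have "\<exists>i\<in>A. d i \<noteq> 0" using c(1) by (auto simp: d_def)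
    ultimately show ?thesis by (metis less_Suc_eq)
  qed
qed

text \<open>The \<open>f i\<close> with \<open>i < n\<close> represent a basis of the degree
  \<open>t\<close> part of \<open>R/I\<close>. Explicit bases are used because the
  \<open>GREATEST\<close> in \<open>hilb\<close> says little until the lengths are known to be
  bounded.\<close>

definition basis_mod :: "'k::field mpoly3 set \<Rightarrow> nat \<Rightarrow> nat \<Rightarrow> (nat \<Rightarrow> 'k mpoly3) \<Rightarrow> bool" where
  "basis_mod I t n f \<longleftrightarrow> (\<forall>i<n. homog t (f i))
     \<and> (\<forall>c. (\<Sum>i<n. const (c i) * f i) \<in> I \<longrightarrow> (\<forall>i<n. c i = 0))
     \<and> (\<forall>g. homog t g \<longrightarrow> (\<exists>c. g - (\<Sum>i<n. const (c i) * f i) \<in> I))"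

text \<open>A longer independent family is impossible: the coordinates of its members with respect
  to \<open>f\<close> satisfy a linear relation, which puts the same combination of the members into
  \<open>I\<close>.\<close>

lemma hilb_eqI:
  assumes I: "is_ideal I" and f: "basis_mod I t n f"
  shows "hilb I t = n"
  unfolding hilb_def
proof (rule Greatest_equality)
  show "\<exists>f. (\<forall>i<n. homog t (f i)) \<and> (\<forall>c. (\<Sum>i<n. const (c i) * f i) \<in> I \<longrightarrow> (\<forall>i<n. c i = 0))"
    using f by (auto simp: basis_mod_def)
next
  fix N :: nat
  assume "\<exists>g :: nat \<Rightarrow> 'a mpoly3. (\<forall>i<N. homog t (g i)) \<and> (\<forall>c. (\<Sum>i<N. const (c i) * g i) \<in> I \<longrightarrow> (\<forall>i<N. c i = 0))"
  then obtain g where g: "\<And>i. i < N \<Longrightarrow> homog t (g i)"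
    "\<And>c. (\<Sum>i<N. const (c i) * g i) \<in> I \<Longrightarrow> (\<forall>i<N. c i = 0)" by blast
  have "\<forall>i\<in>{..<N}. \<exists>c. g i - (\<Sum>j<n. const (c j) * f j) \<in> I"
    using f g(1) by (auto simp: basis_mod_def)
  then obtain M where M: "\<And>i. i < N \<Longrightarrow> g i - (\<Sum>j<n. const (M i j) * f j) \<in> I"
    by (metis lessThan_iff)
  show "N \<le> n"
  proof (rule ccontr)
    assume "\<not> N \<le> n"
    then obtain c where c: "\<exists>i<N. c i \<noteq> 0" "\<And>j. j < n \<Longrightarrow> (\<Sum>i<N. c i * M i j) = 0"
      using nontrivial_linear_relation[of "{..<N}" n M] by auto
    have "(\<Sum>i<N. const (c i) * (\<Sum>j<n. const (M i j) * f j)) = (\<Sum>j<n. const (\<Sum>i<N. c i * M i j) * f j)"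
      by (simp add: sum_distrib_left sum_distrib_right const_sum mult.assoc) (rule sum.swap)
    also have "\<dots> = 0" using c(2) by simp
    finally have "(\<Sum>i<N. const (c i) * g i) = (\<Sum>i<N. const (c i) * (g i - (\<Sum>j<n. const (M i j) * f j)))"
      by (simp add: right_diff_distrib sum_subtractf)
    also have "\<dots> \<in> I" using M by (intro is_ideal_sum[OF I] is_idealD(3)[OF I]) auto
    finally show False using g(2) c(1) by blast
  qed
qed

section \<open>Basic double links along a line\<close>

definition line :: "'k::comm_ring_1 \<Rightarrow> 'k mpoly3" where
  "line c = py - const c * pz"

definition restr :: "'k::comm_ring_1 \<Rightarrow> 'k mpoly3 \<Rightarrow> 'k mpoly3" where
  "restr c = psubst px (const c * pz) pz"

text \<open>Up to a scalar, an arbitrary line through \<open>[\<alpha> i : c : 1]\<close> other than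
  \<open>line c\<close>; the slope \<open>\<beta> i\<close> becomes invisible after
  restriction.\<close>

definition lfactor :: "'k::comm_ring_1 \<Rightarrow> (nat \<Rightarrow> 'k) \<Rightarrow> (nat \<Rightarrow> 'k) \<Rightarrow> nat \<Rightarrow> 'k mpoly3" where
  "lfactor c \<alpha> \<beta> i = px - const (\<alpha> i) * pz - const (\<beta> i) * line c"

definition lprod :: "'k::comm_ring_1 \<Rightarrow> (nat \<Rightarrow> 'k) \<Rightarrow> (nat \<Rightarrow> 'k) \<Rightarrow> nat \<Rightarrow> 'k mpoly3" where
  "lprod c \<alpha> \<beta> m = (\<Prod>i<m. lfactor c \<alpha> \<beta> i)"

definition link_ideal :: "'k::comm_ring_1 mpoly3 \<Rightarrow> 'k mpoly3 \<Rightarrow> 'k mpoly3 set \<Rightarrow> 'k mpoly3 set" where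
  "link_ideal F G I = {G * a + F * b | a b. a \<in> I}"

lemma restr_simps [simp]:
  "restr c (f + g) = restr c f + restr c g" "restr c (f - g) = restr c f - restr c g"
  "restr c (f * g) = restr c f * restr c g" "restr c (const d) = const d"
  "restr c px = px" "restr c pz = pz" "restr c (line c) = 0" "restr c (f ^ n) = restr c f ^ n"
  "restr c (\<Sum>i\<in>A. h i) = (\<Sum>i\<in>A. restr c (h i))"
  by (simp_all add: restr_def line_def)

lemma line_dvd_iff: "line c dvd f \<longleftrightarrow> restr c f = 0"
  unfolding line_def restr_def by (rule linear_dvd_iff_1)

lemma line_neq_0 [simp]: "line c \<noteq> 0"
  by (simp add: line_def)

lemma homog_line: "homog 1 (line c)"
  unfolding line_def by (intro homog_diff homog_const_mult homog_pvar)

lemma homog_lprod: "homog m (lprod c \<alpha> \<beta> m)"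
  unfolding lprod_def lfactor_def
  by (intro homog_prod homog_diff homog_const_mult homog_pvar homog_line)

lemma restr_lprod: "restr c (lprod c \<alpha> \<beta> m) = (\<Prod>i<m. px - const (\<alpha> i) * pz)"
  by (simp add: lprod_def restr_def lfactor_def line_def)

lemma restr_lprod_neq_0 [simp]: "restr c (lprod c \<alpha> \<beta> m) \<noteq> (0 :: 'k::field mpoly3)"
  by (simp add: restr_lprod)

lemma lprod_neq_0 [simp]: "lprod c \<alpha> \<beta> m \<noteq> (0 :: 'k::field mpoly3)"
  using restr_lprod_neq_0[of c \<alpha> \<beta> m] by (metis restr_def psubst_0)

lemma lprod_0 [simp]: "lprod c \<alpha> \<beta> 0 = 1"
  by (simp add: lprod_def)

lemma lprod_Suc: "lprod c \<alpha> \<beta> (Suc i) = lprod c \<alpha> \<beta> i * lfactor c \<alpha> \<beta> i"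
  by (simp add: lprod_def)

text \<open>Restriction to the line kills the left side but not
  \<open>lprod c \<alpha> \<beta> m\<close>, so it kills \<open>b\<close>. This is the regularity of
  the two forms.\<close>

lemma line_mult_eq_lprod_multD:
  fixes b :: "'k::field mpoly3"
  assumes "line c * a = lprod c \<alpha> \<beta> m * b"
  obtains b' where "b = line c * b'" "a = lprod c \<alpha> \<beta> m * b'"
proof -
  have "restr c (lprod c \<alpha> \<beta> m) * restr c b = 0"
    using arg_cong[OF assms, of "restr c"] by simp
  then have "line c dvd b" by (simp add: line_dvd_iff)
  then obtain b' where b': "b = line c * b'" by (rule dvdE)
  with assms have "line c * a = line c * (lprod c \<alpha> \<beta> m * b')" by (simp add: ac_simps)
  with that b' show ?thesis by simp
qed

lemma regular_seq2_lprod_line: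
  fixes c :: "'k::field"
  assumes "m > 0"
  shows "regular_seq2 (lprod c \<alpha> \<beta> m) (line c)"
  unfolding regular_seq2_def
proof (intro conjI allI impI)
  \<comment> \<open>\<open>psubst 0 0 0\<close> takes the constant term. Both forms lie in its
    kernel, the first because \<open>m > 0\<close> makes its product nonempty.\<close>
  have "lprod c \<alpha> \<beta> m \<in> {f. psubst 0 0 0 f = 0}"
    using assms by (simp add: lprod_def lfactor_def line_def)
  moreover have "line c \<in> {f. psubst 0 0 0 f = 0}" by (simp add: line_def)
  moreover have "is_ideal {f :: 'k mpoly3. psubst 0 0 0 f = 0}" by (simp add: is_ideal_def)
  ultimately have "ideal_gen {lprod c \<alpha> \<beta> m, line c} \<subseteq> {f. psubst 0 0 0 f = 0}"
    by (intro ideal_gen_minimal) auto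
  then have "1 \<notin> ideal_gen {lprod c \<alpha> \<beta> m, line c}" by auto
  then show "ideal_gen {lprod c \<alpha> \<beta> m, line c} \<noteq> UNIV" by auto
next
  fix h assume "line c * h \<in> ideal_gen {lprod c \<alpha> \<beta> m}"
  then obtain b where "line c * h = lprod c \<alpha> \<beta> m * b"
    by (auto simp: ideal_gen_singleton elim: dvdE)
  then show "h \<in> ideal_gen {lprod c \<alpha> \<beta> m}"
    by (rule line_mult_eq_lprod_multD) (simp add: ideal_gen_singleton)
qed simp

lemma is_ideal_link_ideal:
  assumes "is_ideal I"
  shows "is_ideal (link_ideal F G I)"
  unfolding is_ideal_def
proof (intro conjI ballI allI)
  show "0 \<in> link_ideal F G I"
    using is_idealD(1)[OF assms] by (auto simp: link_ideal_def intro!: exI[of _ 0])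
next
  fix p q assume "p \<in> link_ideal F G I" "q \<in> link_ideal F G I"
  then obtain a b a' b' where "p = G * a + F * b" "q = G * a' + F * b'" "a \<in> I" "a' \<in> I"
    by (auto simp: link_ideal_def)
  then have "p + q = G * (a + a') + F * (b + b')" "a + a' \<in> I"
    using is_idealD(2)[OF assms] by (simp_all add: algebra_simps)
  then show "p + q \<in> link_ideal F G I" by (auto simp: link_ideal_def)
next
  fix p r assume "p \<in> link_ideal F G I"
  then obtain a b where "p = G * a + F * b" "a \<in> I" by (auto simp: link_ideal_def)
  then have "r * p = G * (r * a) + F * (r * b)" "r * a \<in> I"
    using is_idealD(3)[OF assms] by (simp_all add: algebra_simps)
  then show "r * p \<in> link_ideal F G I" by (auto simp: link_ideal_def)
qed

text \<open>The admissible cofactors of a line in degree \<open>t\<close>. The case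
  \<open>t = 0\<close> keeps the truncated \<open>t - 1\<close> from admitting constants.\<close>

definition homog_pred :: "nat \<Rightarrow> 'k::zero mpoly3 \<Rightarrow> bool" where
  "homog_pred t q \<longleftrightarrow> (if t = 0 then q = 0 else homog (t - 1) q)"

text \<open>Modulo the line, the forms of degree \<open>t\<close> are spanned by the partial products
  \<open>lprod c \<alpha> \<beta> i\<close> padded with powers of \<open>pz\<close>; those with \<open>i \<ge> m\<close> are multiples of \<open>lprod c \<alpha> \<beta> m\<close>.\<close>

definition line_span :: "'k::field \<Rightarrow> (nat \<Rightarrow> 'k) \<Rightarrow> (nat \<Rightarrow> 'k) \<Rightarrow> nat \<Rightarrow> 'k mpoly3 set" where
  "line_span c \<alpha> \<beta> t =
     {(\<Sum>i\<le>t. const (d i) * (lprod c \<alpha> \<beta> i * pz ^ (t - i))) + line c * q | d q. homog_pred t q}"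

lemma line_spanI:
  assumes "f = (\<Sum>i\<le>t. const (d i) * (lprod c \<alpha> \<beta> i * pz ^ (t - i))) + line c * q" "homog_pred t q"
  shows "f \<in> line_span c \<alpha> \<beta> t"
  unfolding line_span_def mem_Collect_eq by (intro exI conjI) (rule assms)+

lemma line_span_add:
  assumes "f \<in> line_span c \<alpha> \<beta> t" "g \<in> line_span c \<alpha> \<beta> t"
  shows "f + g \<in> line_span c \<alpha> \<beta> t"
proof -
  let ?s = "\<lambda>d. \<Sum>i\<le>t. const (d i) * (lprod c \<alpha> \<beta> i * pz ^ (t - i))"
  obtain d q where f: "f = ?s d + line c * q" "homog_pred t q"
    using assms(1) unfolding line_span_def by blast
  obtain e r where g: "g = ?s e + line c * r" "homog_pred t r"
    using assms(2) unfolding line_span_def by blast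
  have "f + g = ?s (\<lambda>i. d i + e i) + line c * (q + r)"
    unfolding f g by (simp add: sum.distrib distrib_left distrib_right add_ac)
  moreover have "homog_pred t (q + r)"
    using f g by (auto simp: homog_pred_def intro: homog_add split: if_splits)
  ultimately show ?thesis by (rule line_spanI)
qed

lemma line_span_const_mult:
  assumes "f \<in> line_span c \<alpha> \<beta> t"
  shows "const a * f \<in> line_span c \<alpha> \<beta> t"
proof -
  let ?s = "\<lambda>d. \<Sum>i\<le>t. const (d i) * (lprod c \<alpha> \<beta> i * pz ^ (t - i))"
  obtain d q where f: "f = ?s d + line c * q" "homog_pred t q"
    using assms unfolding line_span_def by blast
  have "const a * f = ?s (\<lambda>i. a * d i) + line c * (const a * q)"
    unfolding f by (simp add: sum_distrib_left algebra_simps)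
  moreover have "homog_pred t (const a * q)"
    using f by (auto simp: homog_pred_def intro: homog_const_mult split: if_splits)
  ultimately show ?thesis by (rule line_spanI)
qed

lemma line_span_line:
  assumes "homog_pred t q"
  shows "line c * q \<in> line_span c \<alpha> \<beta> t"
  using assms by (intro line_spanI[where d = "\<lambda>_. 0"]) simp_all

lemma line_span_base:
  assumes "i \<le> t"
  shows "lprod c \<alpha> \<beta> i * pz ^ (t - i) \<in> line_span c \<alpha> \<beta> t"
proof -
  have "(\<Sum>j\<le>t. const (if j = i then 1 else 0) * (lprod c \<alpha> \<beta> j * pz ^ (t - j)))
     = (\<Sum>j\<le>t. if j = i then lprod c \<alpha> \<beta> j * pz ^ (t - j) else 0)"
    by (intro sum.cong) auto
  also have "\<dots> = lprod c \<alpha> \<beta> i * pz ^ (t - i)" using assms by simp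
  finally have "lprod c \<alpha> \<beta> i * pz ^ (t - i) =
      (\<Sum>j\<le>t. const (if j = i then 1 else 0) * (lprod c \<alpha> \<beta> j * pz ^ (t - j))) + line c * 0" by simp
  moreover have "homog_pred t (0 :: 'a mpoly3)" by (simp add: homog_pred_def)
  ultimately show ?thesis by (rule line_spanI)
qed

lemma line_span_sum:
  assumes "\<And>i. i \<in> A \<Longrightarrow> f i \<in> line_span c \<alpha> \<beta> t"
  shows "(\<Sum>i\<in>A. f i) \<in> line_span c \<alpha> \<beta> t"
proof -
  have "0 \<in> line_span c \<alpha> \<beta> t" using line_span_line[of t 0 c] by (simp add: homog_pred_def)
  then show ?thesis
    using assms by (induction A rule: infinite_finite_induct) (auto intro: line_span_add)
qed

lemma homog_lprod_pz: "i \<le> t \<Longrightarrow> homog t (lprod c \<alpha> \<beta> i * pz ^ (t - i))"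
  using homog_mult[OF homog_lprod[of i c \<alpha> \<beta>] homog_power[OF homog_pvar, of "t - i" X2]] by simp

text \<open>Multiplication by \<open>px\<close> leads to the next partial product, up to multiples
  of \<open>pz\<close> and of the line; \<open>py\<close> is the line plus a multiple of
  \<open>pz\<close>.\<close>

lemma line_span_pvar_mult_base:
  assumes "i \<le> t"
  shows "pvar v * (lprod c \<alpha> \<beta> i * pz ^ (t - i)) \<in> line_span c \<alpha> \<beta> (Suc t)"
proof -
  have hom: "homog_pred (Suc t) (lprod c \<alpha> \<beta> i * pz ^ (t - i))"
    using homog_lprod_pz[OF assms] by (simp add: homog_pred_def)
  have z: "lprod c \<alpha> \<beta> i * pz ^ Suc (t - i) \<in> line_span c \<alpha> \<beta> (Suc t)"
    using line_span_base[of i "Suc t" c \<alpha> \<beta>] assms by (simp add: Suc_diff_le)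
  show ?thesis
  proof (cases v)
    case X0
    have "pvar v * (lprod c \<alpha> \<beta> i * pz ^ (t - i)) = lprod c \<alpha> \<beta> (Suc i) * pz ^ (Suc t - Suc i)
        + (const (\<alpha> i) * (lprod c \<alpha> \<beta> i * pz ^ Suc (t - i))
        + const (\<beta> i) * (line c * (lprod c \<alpha> \<beta> i * pz ^ (t - i))))"
      unfolding X0 by (simp add: lprod_Suc lfactor_def algebra_simps)
    also have "\<dots> \<in> line_span c \<alpha> \<beta> (Suc t)"
      using assms by (intro line_span_add line_span_const_mult line_span_base line_span_line hom z) simp
    finally show ?thesis .
  next
    case X1
    have "pvar v * (lprod c \<alpha> \<beta> i * pz ^ (t - i)) = line c * (lprod c \<alpha> \<beta> i * pz ^ (t - i))
        + const c * (lprod c \<alpha> \<beta> i * pz ^ Suc (t - i))"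
      unfolding X1 by (simp add: line_def algebra_simps)
    also have "\<dots> \<in> line_span c \<alpha> \<beta> (Suc t)"
      by (intro line_span_add line_span_const_mult line_span_line hom z)
    finally show ?thesis .
  next
    case X2
    then show ?thesis using z by (simp add: ac_simps)
  qed
qed

lemma line_span_pvar_mult:
  assumes "f \<in> line_span c \<alpha> \<beta> t"
  shows "pvar v * f \<in> line_span c \<alpha> \<beta> (Suc t)"
proof -
  obtain d q where f: "f = (\<Sum>i\<le>t. const (d i) * (lprod c \<alpha> \<beta> i * pz ^ (t - i))) + line c * q"
    and q: "homog_pred t q"
    using assms unfolding line_span_def by blast
  have "pvar v * f = (\<Sum>i\<le>t. const (d i) * (pvar v * (lprod c \<alpha> \<beta> i * pz ^ (t - i)))) + line c * (pvar v * q)"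
    unfolding f by (simp add: sum_distrib_left algebra_simps)
  moreover have "homog_pred (Suc t) (pvar v * q)"
    using q homog_mult[OF homog_pvar, of "t - 1" q v] by (cases t) (auto simp: homog_pred_def)
  ultimately show ?thesis
    by (auto intro!: line_span_add line_span_sum line_span_const_mult line_span_pvar_mult_base line_span_line)
qed

text \<open>Multiplication by a variable takes the span in one degree to the next, so every monomial
  is reached from \<open>1\<close>.\<close>

lemma homog_in_line_span:
  assumes "homog t f"
  shows "f \<in> line_span c \<alpha> \<beta> t"
proof -
  have pow: "pvar v ^ n * g \<in> line_span c \<alpha> \<beta> (n + s)" if "g \<in> line_span c \<alpha> \<beta> s" for v n g s
  proof (induction n)
    case (Suc n)
    then show ?case using line_span_pvar_mult[of "pvar v ^ n * g" c \<alpha> \<beta> "n + s" v] by (simp add: mult.assoc)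
  qed (simp add: that)
  have one: "1 \<in> line_span c \<alpha> \<beta> 0"
    using line_span_base[of 0 0 c \<alpha> \<beta>] by simp
  have "Poly_Mapping.single m a \<in> line_span c \<alpha> \<beta> (mdeg m)" for m a
  proof -
    have "mon_val px py pz m \<in> line_span c \<alpha> \<beta> (mdeg m)"
      using pow[OF pow[OF pow[OF one]], of X0 "Poly_Mapping.lookup m X0" X1 "Poly_Mapping.lookup m X1" X2 "Poly_Mapping.lookup m X2"]
      by (simp add: mon_val_def mdeg_def ac_simps)
    then show ?thesis unfolding single_eq_mon_val by (rule line_span_const_mult)
  qed
  then show ?thesis
    using assms by (subst sum_single_lookup) (intro line_span_sum, metis homog_def)
qed

text \<open>The partial products behave like a Newton basis. Apart from term \<open>i\<close>,
  everything is divisible by the partial product of index \<open>Suc i\<close>: earlier terms have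
  coefficient zero by induction, later ones and the right side are multiples.\<close>

lemma partial_products_independent:
  fixes b :: "'k::field mpoly3"
  assumes eq: "(\<Sum>i<k. const (d i) * ((\<Prod>j<i. px - const (\<alpha> j) * pz) * pz ^ (t - i)))
      = (\<Prod>j<m. px - const (\<alpha> j) * pz) * b"
    and "k \<le> m" and "i < k"
  shows "d i = 0"
  using \<open>i < k\<close>
proof (induction i rule: less_induct)
  case (less i)
  let ?p = "\<lambda>j. px - const (\<alpha> j) * pz :: 'k mpoly3"
  let ?P = "\<lambda>i. \<Prod>j<i. ?p j"
  have mono: "?P i dvd ?P j" if "i \<le> j" for i j
    using that by (intro prod_dvd_prod_subset) auto
  let ?f = "\<lambda>j. const (d j) * (?P j * pz ^ (t - j))"
  have "(\<Sum>j<k. ?f j) = ?f i + (\<Sum>j\<in>{..<k} - {i}. ?f j)"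
    using less.prems by (intro sum.remove) auto
  then have f: "?f i = ?P m * b - (\<Sum>j\<in>{..<k} - {i}. ?f j)"
    using eq by simp
  have "?P (Suc i) dvd ?f j" if "j \<in> {..<k} - {i}" for j
  proof (cases "j < i")
    case True
    then show ?thesis using less.IH[of j] that by simp
  next
    case False
    then have "?P (Suc i) dvd ?P j" using that by (intro mono) auto
    then show ?thesis by auto
  qed
  moreover have "?P (Suc i) dvd ?P m" using less.prems \<open>k \<le> m\<close> by (intro mono) auto
  ultimately have "?P (Suc i) dvd ?f i" unfolding f by (intro dvd_diff dvd_mult2[of _ "?P m"] dvd_sum)
  then obtain r where "?f i = ?P (Suc i) * r" by (rule dvdE)
  then have "?P i * (const (d i) * pz ^ (t - i)) = ?P i * (?p i * r)" by (simp add: ac_simps)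
  moreover have "?P i \<noteq> 0" by simp
  \<comment> \<open>The common factor \<open>?P i\<close> is cancelled before substituting, since
    values of \<open>\<alpha>\<close> may repeat. The substitution then kills the right side
    only.\<close>
  ultimately have "const (d i) * pz ^ (t - i) = ?p i * r"
    using mult_left_cancel by blast
  from arg_cong[OF this, of "psubst (const (\<alpha> i) * pz) py pz"]
  show ?case by simp
qed

section \<open>Bases and Hilbert functions of a link\<close>

lemma sum_lessThan_add: "(\<Sum>i<a + k. f i) = (\<Sum>i<a. f i) + (\<Sum>i<k. f (a + i))"
  for f :: "nat \<Rightarrow> 'a::comm_monoid_add"
  by (induction k) (auto simp: add.assoc)

text \<open>The basis comes from the exact sequence
  \<open>0 -> (R/I)(-1) -> R/J -> R/(L,F) -> 0\<close>, whose first map is multiplication by the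
  line \<open>L\<close>. In degree \<open>t\<close> the last term has dimension
  \<open>min (Suc t) m\<close>, with the padded partial products of index below \<open>m\<close> as
  a basis.\<close>

lemma basis_mod_link_ideal:
  fixes I :: "'k::field mpoly3 set"
  assumes I: "is_ideal I" and F: "lprod c \<alpha> \<beta> m \<in> I"
    and f: "if t = 0 then a = 0 else basis_mod I (t - 1) a f"
  shows "basis_mod (link_ideal (lprod c \<alpha> \<beta> m) (line c) I) t (a + min (Suc t) m)
     (\<lambda>i. if i < a then line c * f i else lprod c \<alpha> \<beta> (i - a) * pz ^ (t - (i - a)))"
    (is "basis_mod ?J t (a + ?k) ?g")
proof -
  let ?F = "lprod c \<alpha> \<beta>" and ?L = "line c"
  have f_homog: "homog t (?L * f i)" if "i < a" for i
    using that f homog_mult[OF homog_line, of "t - 1" "f i" c] by (cases t) (auto simp: basis_mod_def)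
  have f_indep: "\<forall>i<a. d i = 0" if "(\<Sum>i<a. const (d i) * f i) \<in> I" for d
    using that f by (cases t) (auto simp: basis_mod_def)
  have f_span: "\<exists>d. q - (\<Sum>i<a. const (d i) * f i) \<in> I" if "homog_pred t q" for q
    using that f is_idealD(1)[OF I] by (cases t) (auto simp: basis_mod_def homog_pred_def)
  have split: "(\<Sum>i<a + ?k. const (d i) * ?g i) = ?L * (\<Sum>i<a. const (d i) * f i)
      + (\<Sum>i<?k. const (d (a + i)) * (?F i * pz ^ (t - i)))" for d
    unfolding sum_lessThan_add by (simp add: sum_distrib_left ac_simps)
  show ?thesis
    unfolding basis_mod_def
  proof (intro conjI allI impI)
    fix i assume "i < a + ?k"
    then show "homog t (?g i)" using f_homog homog_lprod_pz[of "i - a" t c \<alpha> \<beta>] by auto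
  next
    fix d i assume "(\<Sum>i<a + ?k. const (d i) * ?g i) \<in> ?J" and i: "i < a + ?k"
    then obtain A b where A: "A \<in> I" and eq: "?L * (\<Sum>i<a. const (d i) * f i)
      + (\<Sum>i<?k. const (d (a + i)) * (?F i * pz ^ (t - i))) = ?L * A + ?F m * b"
      unfolding split link_ideal_def by blast
    \<comment> \<open>Restriction removes all multiples of \<open>?L\<close>; the remaining partial
      products are independent modulo the restricted form.\<close>
    have "(\<Sum>i<?k. const (d (a + i)) * ((\<Prod>j<i. px - const (\<alpha> j) * pz) * pz ^ (t - i)))
       = (\<Prod>j<m. px - const (\<alpha> j) * pz) * restr c b"
      using arg_cong[OF eq, of "restr c"] by (simp add: restr_lprod)
    from partial_products_independent[OF this] have d: "d (a + i) = 0" if "i < ?k" for i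
      using that by simp
    then have "(\<Sum>i<?k. const (d (a + i)) * (?F i * pz ^ (t - i))) = 0" by simp
    \<comment> \<open>Regularity now yields a relation among the \<open>f i\<close> modulo
      \<open>I\<close>, because the leftover multiple of \<open>?F m\<close> lies in
      \<open>I\<close>.\<close>
    with eq have "?L * ((\<Sum>i<a. const (d i) * f i) - A) = ?F m * b"
      by (simp add: right_diff_distrib)
    then obtain b' where "(\<Sum>i<a. const (d i) * f i) - A = ?F m * b'"
      by (rule line_mult_eq_lprod_multD)
    then have "(\<Sum>i<a. const (d i) * f i) = A + ?F m * b'" by (simp add: algebra_simps)
    then have "(\<Sum>i<a. const (d i) * f i) \<in> I"
      using A F by (simp add: is_idealD(2,4)[OF I])
    then have "\<forall>i<a. d i = 0" by (rule f_indep)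
    moreover have "i = a + (i - a)" "i - a < ?k" if "\<not> i < a" using that i by linarith+
    ultimately show "d i = 0" using d by metis
  next
    fix g :: "'k mpoly3" assume "homog t g"
    then obtain e q where g: "g = (\<Sum>i\<le>t. const (e i) * (?F i * pz ^ (t - i))) + ?L * q" and q: "homog_pred t q"
      using homog_in_line_span[of t g c \<alpha> \<beta>] unfolding line_span_def by blast
    from f_span[OF q] obtain d where d: "q - (\<Sum>i<a. const (d i) * f i) \<in> I" by blast
    let ?h = "\<lambda>i. const (e i) * (?F i * pz ^ (t - i))"
    have union: "{..t} = {..<?k} \<union> {?k..t}" by auto
    have e: "(\<Sum>i\<le>t. ?h i) = (\<Sum>i<?k. ?h i) + (\<Sum>i\<in>{?k..t}. ?h i)"
      unfolding union by (rule sum.union_disjoint) auto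
    \<comment> \<open>These terms have index at least \<open>m\<close>; if \<open>m > t\<close> the
      range is empty.\<close>
    have "?F m dvd (\<Sum>i\<in>{?k..t}. ?h i)"
    proof (rule dvd_sum)
      fix i assume "i \<in> {?k..t}"
      then have "?F m dvd ?F i" unfolding lprod_def by (intro prod_dvd_prod_subset) auto
      then show "?F m dvd ?h i" by auto
    qed
    then obtain b where b: "(\<Sum>i\<in>{?k..t}. ?h i) = ?F m * b" by (rule dvdE)
    define s where "s i = (if i < a then d i else e (i - a))" for i
    have "(\<Sum>i<a + ?k. const (s i) * ?g i) = ?L * (\<Sum>i<a. const (d i) * f i) + (\<Sum>i<?k. ?h i)"
      unfolding split by (simp add: s_def)
    then have "g - (\<Sum>i<a + ?k. const (s i) * ?g i) = ?L * (q - (\<Sum>i<a. const (d i) * f i)) + ?F m * b"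
      unfolding g e b by (simp add: algebra_simps)
    then show "\<exists>s. g - (\<Sum>i<a + ?k. const (s i) * ?g i) \<in> ?J"
      using d unfolding link_ideal_def by blast
  qed
qed

text \<open>Makes \<open>hilb I t\<close> a true dimension in every degree, so that the next link
  can start from a basis.\<close>

definition has_bases :: "'k::field mpoly3 set \<Rightarrow> bool" where
  "has_bases I \<longleftrightarrow> (\<forall>t. \<exists>f. basis_mod I t (hilb I t) f)"

lemma hilb_link_ideal:
  fixes I :: "'k::field mpoly3 set"
  assumes I: "is_ideal I" and F: "lprod c \<alpha> \<beta> m \<in> I" and bases: "has_bases I"
  defines "J \<equiv> link_ideal (lprod c \<alpha> \<beta> m) (line c) I"
  shows "has_bases J"
    and "hilb J t = (if t = 0 then 0 else hilb I (t - 1)) + min (Suc t) m"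
proof -
  have *: "\<exists>g. basis_mod J t ((if t = 0 then 0 else hilb I (t - 1)) + min (Suc t) m) g" for t
  proof -
    obtain f where "basis_mod I (t - 1) (hilb I (t - 1)) f"
      using bases unfolding has_bases_def by blast
    then have "if t = 0 then (if t = 0 then 0 else hilb I (t - 1)) = 0
      else basis_mod I (t - 1) (if t = 0 then 0 else hilb I (t - 1)) f" by simp
    from basis_mod_link_ideal[OF I F this] show ?thesis unfolding J_def by blast
  qed
  moreover have "is_ideal J" unfolding J_def by (rule is_ideal_link_ideal[OF I])
  ultimately show h: "hilb J t = (if t = 0 then 0 else hilb I (t - 1)) + min (Suc t) m" for t
    using hilb_eqI by metis
  show "has_bases J" unfolding has_bases_def h using * by blast
qed

lemma hilb_UNIV: "hilb (UNIV :: 'k::field mpoly3 set) t = 0" "has_bases (UNIV :: 'k mpoly3 set)"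
proof -
  have *: "basis_mod (UNIV :: 'k mpoly3 set) t 0 f" for t f
    by (simp add: basis_mod_def)
  show h: "hilb (UNIV :: 'k mpoly3 set) t = 0" for t
    using hilb_eqI[OF is_ideal_UNIV *] .
  show "has_bases (UNIV :: 'k mpoly3 set)"
    unfolding has_bases_def h using * by blast
qed

section \<open>Partially doubled spread out configurations\<close>

definition mult_ideal :: "nat \<Rightarrow> 'k::comm_ring_1 \<Rightarrow> 'k \<Rightarrow> 'k mpoly3 set" where
  "mult_ideal e a b = (if e = 1 then pt_ideal a b else dbl_ideal a b)"

text \<open>A pair \<open>(e, n)\<close> stands for the row of \<open>n\<close> points taken with multiplicity \<open>e \<in> {1, 2}\<close>.\<close>

definition conf_ideal :: "nat \<Rightarrow> (nat \<times> nat) list \<Rightarrow> 'k::comm_ring_1 mpoly3 set" where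
  "conf_ideal N ps = (\<Inter>(e, n)\<in>set ps. \<Inter>j<n. mult_ideal e (of_nat j) (of_nat (N - n)))"

text \<open>The form linking in a row \<open>(e, n)\<close> is a product of \<open>e * n div 2\<close> vertical lines
  \<open>x = j z\<close>, and of as many diagonals \<open>x + y = (N - 1 - j) z\<close> as are missing to degree \<open>e * n\<close>.\<close>

definition row_coeff :: "nat \<Rightarrow> nat \<Rightarrow> nat \<Rightarrow> 'k::comm_ring_1" where
  "row_coeff e n i = (if i < e * n div 2 then of_nat i else of_nat (n - Suc (i - e * n div 2)))"

definition row_slope :: "nat \<Rightarrow> nat \<Rightarrow> nat \<Rightarrow> 'k::comm_ring_1" where
  "row_slope e n i = (if i < e * n div 2 then 0 else -1)"

definition row_form :: "nat \<Rightarrow> nat \<Rightarrow> nat \<Rightarrow> 'k::comm_ring_1 mpoly3" where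
  "row_form N e n = lprod (of_nat (N - n)) (row_coeff e n) (row_slope e n) (e * n)"

lemma is_ideal_mult_ideal: "is_ideal (mult_ideal e a b)"
  by (simp add: mult_ideal_def is_ideal_pt_ideal is_ideal_dbl_ideal)

lemma is_ideal_conf_ideal: "is_ideal (conf_ideal N ps)"
  unfolding conf_ideal_def by (auto intro!: is_ideal_INT is_ideal_mult_ideal)

section \<open>Linking forms of the rows\<close>

lemma prod_lessThan_add: "(\<Prod>i<a + k. f i) = (\<Prod>i<a. f i) * (\<Prod>i<k. f (a + i))"
  for f :: "nat \<Rightarrow> 'a::comm_monoid_mult"
  by (induction k) (auto simp: mult.assoc)

lemma row_form_split:
  fixes N n e :: nat
  defines "a \<equiv> e * n div 2"
  shows "row_form N e n = (\<Prod>i<a. px - const (of_nat i) * pz)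
     * (\<Prod>i<e * n - a. px - const (of_nat (n - Suc i)) * pz + line (of_nat (N - n)) :: 'k::comm_ring_1 mpoly3)"
proof -
  have "e * n = a + (e * n - a)" by (simp add: a_def)
  then have "row_form N e n = (\<Prod>i<a + (e * n - a). lfactor (of_nat (N - n)) (row_coeff e n) (row_slope e n) i :: 'k mpoly3)"
    by (simp add: row_form_def lprod_def)
  then show ?thesis
    unfolding prod_lessThan_add by (simp add: lfactor_def row_coeff_def row_slope_def flip: a_def)
qed

text \<open>Counting from zero, the vertical line \<open>i\<close> contains point \<open>i\<close>
  of each row long enough, and diagonal \<open>i\<close> contains point \<open>i\<close> from the
  right end. A simple point needs one of its two lines, which \<open>n' \<le> e * n\<close>
  supplies; a double point needs both, which \<open>2 * n' \<le> e * n\<close> supplies.\<close>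

lemma row_form_in_mult_ideal:
  assumes e': "e' \<in> {1, 2}" and le: "e' * n' \<le> e * n" and e: "e \<le> 2"
    and n: "n \<le> N" and n': "n' \<le> N" and j: "j < n'"
  shows "row_form N e n \<in> (mult_ideal e' (of_nat j) (of_nat (N - n')) :: 'k::idom mpoly3 set)"
proof -
  define a where "a = e * n div 2"
  let ?A = "\<Prod>i<a. px - const (of_nat i) * pz :: 'k mpoly3"
  let ?B = "\<Prod>i<e * n - a. px - const (of_nat (n - Suc i)) * pz + line (of_nat (N - n)) :: 'k mpoly3"
  let ?pt = "pt_ideal (of_nat j) (of_nat (N - n')) :: 'k mpoly3 set"
  have A: "?A \<in> ?pt" if "j < a"
    using that by (auto simp: pt_ideal_def pt_eval_def)
  have B: "?B \<in> ?pt" if i: "n' - Suc j < e * n - a"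
  proof -
    let ?i = "n' - Suc j"
    \<comment> \<open>At most \<open>n\<close> diagonals occur, so the truncated
      \<open>n - Suc ?i\<close> is exact.\<close>
    have "e * n \<le> 2 * n" using e by simp
    then have "e * n - a \<le> n" unfolding a_def by linarith
    then have "?i < n" using i by simp
    \<comment> \<open>Both sides are \<open>N - Suc ?i\<close>, the value of \<open>x + y\<close> on
      the diagonal, which does not depend on the row.\<close>
    then have "j + (N - n') = (n - Suc ?i) + (N - n)" using n n' j by simp
    then have "of_nat j + of_nat (N - n') = (of_nat (n - Suc ?i) + of_nat (N - n) :: 'k)"
      by (metis of_nat_add)
    then have "(const (of_nat j) + const (of_nat (N - n'))) * pz
        = (const (of_nat (n - Suc ?i)) + const (of_nat (N - n)) :: 'k mpoly3) * pz"
      by (metis const_simps(3))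
    then have "pt_eval (of_nat j) (of_nat (N - n')) (px - const (of_nat (n - Suc ?i)) * pz + line (of_nat (N - n))) = (0 :: 'k mpoly3)"
      by (simp add: pt_eval_def line_def algebra_simps del: of_nat_add)
    then show ?thesis using i by (auto simp: pt_ideal_def pt_eval_def)
  qed
  have form: "row_form N e n = ?A * ?B" unfolding a_def by (rule row_form_split)
  show ?thesis
  proof (cases "e' = 1")
    case True
    then have "n' \<le> e * n" using le by simp
    then have "j < a \<or> n' - Suc j < e * n - a" using j by linarith
    then have "?A * ?B \<in> ?pt" using A B pt_ideal_prime by blast
    then show ?thesis using True form by (simp add: mult_ideal_def)
  next
    case False
    then have "n' \<le> a" "n' \<le> e * n - a" using le e' by (auto simp: a_def)
    then have "?A * ?B \<in> dbl_ideal (of_nat j) (of_nat (N - n'))"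
      using j by (intro pt_ideal_mult A B) auto
    then show ?thesis using False form by (simp add: mult_ideal_def)
  qed
qed

text \<open>On the line of the row the vertical lines cut out points from the left and the diagonals
  from the right. For \<open>e = 1\<close> they meet without overlap; for \<open>e = 2\<close> each
  family cuts out all \<open>n\<close> points.\<close>

lemma restr_row_form:
  assumes "e \<in> {1, 2}"
  shows "restr (of_nat (N - n)) (row_form N e n) = (\<Prod>j<n. (px - const (of_nat j) * pz) ^ e :: 'k::comm_ring_1 mpoly3)"
proof -
  define a where "a = e * n div 2"
  define b where "b = e * n - a"
  let ?p = "\<lambda>j. px - const (of_nat j) * pz :: 'k mpoly3"
  have restr_prod: "restr c (\<Prod>i\<in>A. f i) = (\<Prod>i\<in>A. restr c (f i))" for c A and f :: "nat \<Rightarrow> 'k mpoly3"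
    by (simp add: restr_def)
  have "b \<le> n" using assms by (auto simp: a_def b_def)
  have "restr (of_nat (N - n)) (row_form N e n) = (\<Prod>i<a. ?p i) * (\<Prod>i<b. ?p (n - Suc i))"
    unfolding row_form_split by (simp add: restr_prod a_def b_def)
  also have "(\<Prod>i<b. ?p (n - Suc i)) = (\<Prod>i<b. ?p (n - b + (b - Suc i)))"
    using \<open>b \<le> n\<close> by (intro prod.cong) auto
  also have "\<dots> = (\<Prod>i<b. ?p (n - b + i))"
    by (rule prod.nat_diff_reindex)
  also have "(\<Prod>i<a. ?p i) * (\<Prod>i<b. ?p (n - b + i)) = (\<Prod>j<n. ?p j ^ e)"
  proof (cases "e = 1")
    case True
    then have "n = a + b" "n - b = a" by (auto simp: a_def b_def)
    then have "(\<Prod>j<n. ?p j) = (\<Prod>i<a. ?p i) * (\<Prod>i<b. ?p (n - b + i))"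
      using prod_lessThan_add[of ?p a b] by simp
    with True show ?thesis by simp
  next
    case False
    then have "e = 2" "a = n" "b = n" using assms by (auto simp: a_def b_def)
    then show ?thesis by (simp add: power2_eq_square prod.distrib)
  qed
  finally show ?thesis .
qed

text \<open>The linear form is prime and does not divide \<open>A\<close>, so its powers are peeled
  off \<open>B\<close> one at a time.\<close>

lemma linear_power_dvd_multD:
  fixes A B :: "'k::field mpoly3"
  assumes "(px - const a * pz) ^ e dvd A * B" and A: "psubst (const a * pz) py pz A \<noteq> 0"
  shows "(px - const a * pz) ^ e dvd B"
  using assms(1)
proof (induction e arbitrary: B)
  case (Suc e)
  let ?u = "px - const a * pz :: 'k mpoly3"
  have "?u dvd A * B" using Suc.prems by (metis dvd_mult_left power_Suc)
  then have "?u dvd B" using A by (simp add: linear_dvd_iff_0)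
  then obtain B' where B': "B = ?u * B'" by (rule dvdE)
  with Suc.prems have "?u * ?u ^ e dvd ?u * (A * B')" by (simp add: ac_simps)
  then have "?u ^ e dvd A * B'" by (simp only: dvd_mult_cancel_left) simp
  then have "?u ^ e dvd B'" by (rule Suc.IH)
  then show ?case unfolding B' by simp
qed simp

text \<open>Distinct \<open>j\<close> give coprime linear forms because \<open>of_nat\<close> is
  injective in characteristic zero.\<close>

lemma prod_linear_power_dvd:
  fixes h :: "'k::field_char_0 mpoly3"
  assumes "\<And>j. j < n \<Longrightarrow> (px - const (of_nat j) * pz) ^ e dvd h"
  shows "(\<Prod>j<n. (px - const (of_nat j) * pz) ^ e) dvd h"
  using assms
proof (induction n)
  case (Suc n)
  let ?u = "\<lambda>j. px - const (of_nat j) * pz :: 'k mpoly3"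
  let ?P = "\<Prod>j<n. ?u j ^ e" and ?\<sigma> = "psubst (const (of_nat n) * pz) py pz"
  have "?P dvd h" by (rule Suc.IH, rule Suc.prems) simp
  then obtain q where q: "h = ?P * q" by (rule dvdE)
  have \<sigma>: "?\<sigma> (?u j) \<noteq> 0" if "j < n" for j
  proof -
    have "?\<sigma> (?u j) = const (of_nat n - of_nat j) * pz"
      by (simp add: left_diff_distrib)
    moreover have "const (of_nat n - of_nat j :: 'k) \<noteq> 0"
      using that unfolding const_eq_0_iff by simp
    ultimately show ?thesis by (metis mult_eq_0_iff pvar_neq_0)
  qed
  have "?\<sigma> ?P \<noteq> 0"
  proof
    assume "?\<sigma> ?P = 0"
    then have "(\<Prod>j<n. ?\<sigma> (?u j) ^ e) = 0" by (simp only: psubst_prod psubst_power)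
    then obtain j where "j < n" "?\<sigma> (?u j) ^ e = 0" by (auto simp only: prod_zero_iff finite_lessThan)
    with \<sigma>[of j] show False by (metis power_not_zero)
  qed
  moreover have "?u n ^ e dvd ?P * q"
    unfolding q[symmetric] by (rule Suc.prems) simp
  ultimately have "?u n ^ e dvd q"
    by (rule linear_power_dvd_multD[rotated])
  then show ?case
    unfolding q prod.lessThan_Suc by (rule mult_dvd_mono[OF dvd_refl])
qed simp

text \<open>Generators containing the factor \<open>line b\<close> restrict to zero, which leaves
  only the power of the other linear form.\<close>

lemma restr_mult_ideal_dvd:
  assumes "e \<in> {1, 2}" "g \<in> mult_ideal e a b"
  shows "(px - const a * pz) ^ e dvd restr b g"
proof (cases "e = 1")
  case True
  with assms have "g \<in> pt_ideal a b" by (simp add: mult_ideal_def)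
  then obtain p q where "g = (px - const a * pz) * p + line b * q"
    unfolding line_def by (rule pt_idealE)
  then show ?thesis using True by simp
next
  case False
  with assms have "g \<in> dbl_ideal a b" by (simp add: mult_ideal_def)
  then obtain p q r where "g = (px - const a * pz) * (px - const a * pz) * p + (px - const a * pz) * line b * q + line b * line b * r"
    unfolding line_def by (rule dbl_idealE)
  then show ?thesis using False assms by (simp add: power2_eq_square)
qed

lemma line_in_pt_ideal_iff:
  "line c \<in> pt_ideal a b \<longleftrightarrow> b = (c :: 'k::field)"
proof -
  have "pt_eval a b (line c) = const (b - c) * pz"
    by (simp add: pt_eval_def line_def algebra_simps)
  then have "line c \<in> pt_ideal a b \<longleftrightarrow> const (b - c) * pz = (0 :: 'k mpoly3)"
    by (simp add: pt_ideal_def)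
  also have "\<dots> \<longleftrightarrow> b - c = 0" by (simp only: mult_eq_0_iff const_eq_0_iff pvar_neq_0 simp_thms)
  finally show ?thesis by simp
qed

lemma mult_ideal_colon:
  fixes f g :: "'k::idom mpoly3"
  shows "f * g \<in> mult_ideal e a b \<Longrightarrow> f \<notin> pt_ideal a b \<Longrightarrow> g \<in> mult_ideal e a b"
  using dbl_ideal_colon[of f g a b] pt_ideal_prime[of f g a b] by (auto simp: mult_ideal_def split: if_splits)

text \<open>Sorting by \<open>e * n\<close> orders rows by the degree of their linking forms. A
  double row requires its simple row, so each link raises the multiplicity of a row by one.\<close>

definition valid_rows :: "nat \<Rightarrow> (nat \<times> nat) list \<Rightarrow> bool" where
  "valid_rows N ps \<longleftrightarrow> sorted (map (\<lambda>(e, n). e * n) ps) \<and> distinct ps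
     \<and> (\<forall>(e, n)\<in>set ps. e \<in> {1, 2} \<and> 0 < n \<and> n \<le> N \<and> (e = 2 \<longrightarrow> (1, n) \<in> set ps))"

lemma valid_rowsD:
  assumes "valid_rows N ps" "(e, n) \<in> set ps"
  shows "e = 1 \<or> e = 2" "0 < n" "n \<le> N" "e = 2 \<Longrightarrow> (1, n) \<in> set ps"
  using assms by (auto simp: valid_rows_def)

lemma valid_rows_snocD:
  assumes "valid_rows N (ps @ [(e, n)])"
  shows "valid_rows N ps" and "\<And>e' n'. (e', n') \<in> set ps \<Longrightarrow> e' * n' \<le> e * n"
    and "(e, n) \<notin> set ps" and "e = 1 \<or> e = 2" "0 < n" "n \<le> N"
    and "e = 2 \<Longrightarrow> (1, n) \<in> set ps"
proof -
  note D = valid_rowsD[OF assms]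
  show le: "e' * n' \<le> e * n" if "(e', n') \<in> set ps" for e' n'
    using assms that by (force simp: valid_rows_def sorted_append)
  show "(e, n) \<notin> set ps" "e = 1 \<or> e = 2" "0 < n" "n \<le> N"
    using assms by (auto simp: valid_rows_def)
  show "e = 2 \<Longrightarrow> (1, n) \<in> set ps" using D(4)[of e n] by auto
  \<comment> \<open>The simple row of \<open>n'\<close> cannot be the final entry, since sortedness
    would give \<open>2 * n' \<le> n'\<close>.\<close>
  have "(1, n') \<in> set ps" if "(2, n') \<in> set ps" for n'
    using D(4)[of 2 n'] D(2)[of 2 n'] le[OF that] that by auto
  then show "valid_rows N ps"
    using assms by (auto simp: valid_rows_def sorted_append)
qed

text \<open>An element of the new ideal restricts on the line to a multiple of the restricted
  \<open>row_form\<close>. Subtracting that multiple of the form leaves a multiple of the line, and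
  colon computations place its cofactor in the old ideal.\<close>

lemma conf_ideal_snoc:
  assumes valid: "valid_rows N (ps @ [(e, n)])"
  shows "row_form N e n \<in> (conf_ideal N ps :: 'k::field_char_0 mpoly3 set)"
    and "conf_ideal N (ps @ [(e, n)]) =
      link_ideal (row_form N e n) (line (of_nat (N - n))) (conf_ideal N ps :: 'k mpoly3 set)"
proof -
  note D = valid_rows_snocD[OF valid]
  note P = valid_rowsD[OF D(1)]
  let ?F = "row_form N e n :: 'k mpoly3" and ?L = "line (of_nat (N - n)) :: 'k mpoly3"
  let ?M = "\<lambda>e n j. mult_ideal e (of_nat j) (of_nat (N - n)) :: 'k mpoly3 set"
  have e: "e \<in> {1, 2}" using D by simp
  have conf: "f \<in> conf_ideal N qs \<longleftrightarrow> (\<forall>e n j. (e, n) \<in> set qs \<longrightarrow> j < n \<longrightarrow> f \<in> ?M e n j)" for f qs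
    by (auto simp: conf_ideal_def)
  have conf_snoc: "f \<in> conf_ideal N (ps @ [(e, n)]) \<longleftrightarrow> f \<in> conf_ideal N ps \<and> (\<forall>j<n. f \<in> ?M e n j)" for f
    unfolding conf by auto
  have e_le: "e \<le> 2" using e by auto
  have FM: "?F \<in> ?M e n j" if "j < n" for j
    by (rule row_form_in_mult_ideal[OF e order_refl e_le D(6) D(6) that])
  show F: "?F \<in> conf_ideal N ps"
    unfolding conf
  proof (intro allI impI)
    fix e' n' j assume n': "(e', n') \<in> set ps" and j: "j < n'"
    have "e' \<in> {1, 2}" using P(1)[OF n'] by simp
    then show "?F \<in> ?M e' n' j"
      using D(2)[OF n'] e_le D(6) P(3)[OF n'] j by (rule row_form_in_mult_ideal)
  qed
  have L: "?L \<in> pt_ideal (of_nat j) (of_nat (N - n))" for j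
    by (simp add: line_in_pt_ideal_iff)
  show "conf_ideal N (ps @ [(e, n)]) = link_ideal ?F ?L (conf_ideal N ps)"
  proof (intro equalityI subsetI)
    fix g assume g: "g \<in> link_ideal ?F ?L (conf_ideal N ps)"
    then obtain a b where g: "g = ?L * a + ?F * b" and a: "a \<in> conf_ideal N ps"
      by (auto simp: link_ideal_def)
    \<comment> \<open>For a double row, \<open>a\<close> already vanishes on the simple row, and the
      line supplies the second factor.\<close>
    have La: "?L * a \<in> ?M e n j" if "j < n" for j
    proof (cases "e = 1")
      case True
      then show ?thesis using L by (simp add: mult_ideal_def pt_ideal_prime)
    next
      case False
      then have "a \<in> pt_ideal (of_nat j) (of_nat (N - n))"
        using e a D(7) that unfolding conf by (force simp: mult_ideal_def)
      then show ?thesis using False pt_ideal_mult[OF L] by (simp add: mult_ideal_def)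
    qed
    have "g \<in> ?M e n j" if "j < n" for j
      unfolding g by (intro is_idealD(2)[OF is_ideal_mult_ideal] is_idealD(4)[OF is_ideal_mult_ideal FM] La that)
    moreover have "g \<in> conf_ideal N ps"
      unfolding g using a F is_idealD[OF is_ideal_conf_ideal] by metis
    ultimately show "g \<in> conf_ideal N (ps @ [(e, n)])" by (simp only: conf_snoc) blast
  next
    fix g :: "'k mpoly3" assume g: "g \<in> conf_ideal N (ps @ [(e, n)])"
    then have "g \<in> ?M e n j" if "j < n" for j using that by (simp only: conf_snoc)
    then have "(px - const (of_nat j) * pz) ^ e dvd restr (of_nat (N - n)) g" if "j < n" for j
      using restr_mult_ideal_dvd[OF e, of g "of_nat j"] that by blast
    then have "restr (of_nat (N - n)) ?F dvd restr (of_nat (N - n)) g"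
      unfolding restr_row_form[OF e] by (rule prod_linear_power_dvd)
    then obtain h where h: "restr (of_nat (N - n)) g = restr (of_nat (N - n)) ?F * h" by (rule dvdE)
    \<comment> \<open>The quotient \<open>h\<close> may involve \<open>py\<close>; restricting once
      more replaces it by its restriction.\<close>
    have restr_restr: "restr c (restr c f) = restr c f" for c and f :: "'k mpoly3"
    proof -
      have "line c dvd f - restr c f"
        unfolding restr_def using diff_psubst_in_ideal[OF is_ideal_principal[of "line c"], where A = px and B = "const c * pz" and C = pz and f = f]
        by (simp add: line_def)
      then show ?thesis by (simp add: line_dvd_iff)
    qed
    have "restr (of_nat (N - n)) (g - ?F * h) = 0"
      using arg_cong[OF h, of "restr (of_nat (N - n))"] by (simp add: restr_restr)
    then have "?L dvd g - ?F * h" by (simp add: line_dvd_iff)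
    then obtain q where q: "g - ?F * h = ?L * q" by (rule dvdE)
    have F': "?F * h \<in> conf_ideal N (ps @ [(e, n)])"
    proof -
      have "?F \<in> conf_ideal N (ps @ [(e, n)])"
        using F FM by (simp only: conf_snoc) blast
      then show ?thesis by (rule is_idealD(4)[OF is_ideal_conf_ideal])
    qed
    have Lq: "?L * q \<in> conf_ideal N (ps @ [(e, n)])"
      unfolding q[symmetric] using g F' by (intro is_idealD(6)[OF is_ideal_conf_ideal])
    have "q \<in> conf_ideal N ps"
      unfolding conf
    proof (intro allI impI)
      fix e' n' j assume n': "(e', n') \<in> set ps" and j: "j < n'"
      have Lq': "?L * q \<in> ?M e' n' j" using Lq n' j by (simp only: conf_snoc) (simp only: conf)
      show "q \<in> ?M e' n' j"
      proof (cases "n' = n")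
        case False
        then have "N - n' \<noteq> N - n" using D(6) P(3)[OF n'] by linarith
        then have "?L \<notin> pt_ideal (of_nat j) (of_nat (N - n'))" by (simp add: line_in_pt_ideal_iff)
        with Lq' show ?thesis by (rule mult_ideal_colon)
      next
        case True
        \<comment> \<open>The only old row on this line is the simple copy of the new one. Dividing
          the double point condition by the line leaves exactly the simple one.\<close>
        have "e' \<noteq> e" "e' * n \<le> e * n" using n' D(3) D(2)[OF n'] True by auto
        then have "e' = 1" "e = 2" using P(1)[OF n'] D(4,5) by auto
        have "?L * q \<in> ?M e n j" using Lq j True by (simp only: conf_snoc)
        then have "q \<in> pt_ideal (of_nat j) (of_nat (N - n))"
          using \<open>e = 2\<close> by (auto simp: mult_ideal_def line_def intro: dbl_ideal_colon_line)
        then show ?thesis using \<open>e' = 1\<close> True by (simp add: mult_ideal_def)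
      qed
    qed
    moreover have "g = ?L * q + ?F * h" using q by (simp add: algebra_simps)
    ultimately show "g \<in> link_ideal ?F ?L (conf_ideal N ps)" unfolding link_ideal_def by blast
  qed
qed

section \<open>Chains of links and first differences\<close>

lemma obtained_by_bdl_UNIV: "obtained_by_bdl UNIV"
  unfolding obtained_by_bdl_def by (rule exI[of _ "[UNIV]"]) simp

lemma obtained_by_bdl_step:
  assumes "obtained_by_bdl I" "basic_double_link I J"
  shows "obtained_by_bdl J"
proof -
  obtain Is where Is: "Is \<noteq> []" "hd Is = UNIV" "last Is = I"
    "\<And>i. Suc i < length Is \<Longrightarrow> basic_double_link (Is ! i) (Is ! Suc i)"
    using assms(1) by (auto simp: obtained_by_bdl_def)
  have "basic_double_link ((Is @ [J]) ! i) ((Is @ [J]) ! Suc i)" if "Suc i < length (Is @ [J])" for i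
  proof (cases "Suc i < length Is")
    case True
    then show ?thesis using Is(4) by (simp add: nth_append)
  next
    case False
    then have "Suc i = length Is" using that by simp
    then have "Is ! i = I" using Is(1,3) by (metis diff_Suc_1 last_conv_nth)
    then show ?thesis using \<open>Suc i = length Is\<close> assms(2) by (simp add: nth_append)
  qed
  then show ?thesis unfolding obtained_by_bdl_def using Is(1,2) by (intro exI[of _ "Is @ [J]"]) simp
qed

text \<open>The first difference of \<open>min (t + 1) m\<close>; with an integer argument, shifted
  blocks vanish at negative positions.\<close>

definition block :: "nat \<Rightarrow> int \<Rightarrow> int" where
  "block m s = (if 0 \<le> s \<and> s < int m then 1 else 0)"

text \<open>Each new row moves all older blocks up by one degree and starts its own block in degree
  0, so block \<open>i\<close> ends up shifted by the number of later rows.\<close>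

lemma conf_ideal_bdl_and_dhilb:
  assumes "valid_rows N ps"
  defines "I \<equiv> conf_ideal N ps :: 'k::field_char_0 mpoly3 set"
    and "ms \<equiv> map (\<lambda>(e, n). e * n) ps"
  shows "obtained_by_bdl I \<and> has_bases I
    \<and> (\<forall>t. dhilb I t = (\<Sum>i\<in>{1..length ms}. block (ms ! (i - 1)) (int t - int (length ms - i))))"
  using assms(1) unfolding I_def ms_def
proof (induction ps rule: rev_induct)
  case Nil
  have "conf_ideal N [] = (UNIV :: 'k mpoly3 set)" by (simp add: conf_ideal_def)
  then show ?case by (simp add: obtained_by_bdl_UNIV hilb_UNIV dhilb_def)
next
  case (snoc x ps)
  obtain e n where x: "x = (e, n)" by fastforce
  note valid = snoc.prems[unfolded x]
  note D = valid_rows_snocD[OF valid]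
  let ?I = "conf_ideal N ps :: 'k mpoly3 set"
  let ?F = "row_form N e n :: 'k mpoly3" and ?L = "line (of_nat (N - n)) :: 'k mpoly3"
  let ?J = "link_ideal ?F ?L ?I"
  let ?ms = "map (\<lambda>(e, n). e * n) ps"
  let ?m = "e * n"
  have m: "?m > 0" using D(4,5) by auto
  note IH = snoc.IH[OF D(1)]
  note F = conf_ideal_snoc(1)[OF valid, where 'k = 'k]
  have "basic_double_link ?I ?J"
    unfolding basic_double_link_def is_form_def
  proof (intro exI conjI)
    show "homog ?m ?F" unfolding row_form_def by (rule homog_lprod)
    show "homog 1 ?L" by (rule homog_line)
    show "?F \<in> ?I" by (rule F)
    show "regular_seq2 ?F ?L" unfolding row_form_def using m by (rule regular_seq2_lprod_line)
    show "?J = {?L * a + ?F * b | a b. a \<in> ?I}" by (simp add: link_ideal_def)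
  qed
  with IH have "obtained_by_bdl ?J" by (blast intro: obtained_by_bdl_step)
  have bases: "has_bases ?I" using IH by blast
  note H = hilb_link_ideal[OF is_ideal_conf_ideal F[unfolded row_form_def] bases, folded row_form_def]
  have dh: "dhilb ?J t = block ?m (int t) + (if t = 0 then 0 else dhilb ?I (t - 1))" for t
  proof (cases t)
    case 0
    then show ?thesis using m by (simp add: dhilb_def H(2) block_def Suc_le_eq)
  next
    case (Suc s)
    have "int (min (Suc (Suc s)) k) - int (min (Suc s) k) = block k (int (Suc s))" for k
      by (auto simp: block_def)
    from this[of ?m] show ?thesis unfolding Suc by (cases s) (simp_all add: dhilb_def H(2))
  qed
  let ?p = "length ?ms"
  have "dhilb ?J t = (\<Sum>i\<in>{1..Suc ?p}. block ((?ms @ [?m]) ! (i - 1)) (int t - int (Suc ?p - i)))" for t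
  proof -
    have shift: "block ((?ms @ [?m]) ! (i - 1)) (int t - int (Suc ?p - i)) = block (?ms ! (i - 1)) (int t - 1 - int (?p - i))"
      if i: "i \<in> {1..?p}" for i
    proof -
      have "i - 1 < ?p" using i by auto
      then have "(?ms @ [?m]) ! (i - 1) = ?ms ! (i - 1)" by (simp only: nth_append if_True)
      moreover have "int t - int (Suc ?p - i) = int t - 1 - int (?p - i)" using i by auto
      ultimately show ?thesis by (simp only:)
    qed
    have "(\<Sum>i\<in>{1..Suc ?p}. block ((?ms @ [?m]) ! (i - 1)) (int t - int (Suc ?p - i)))
      = (\<Sum>i\<in>{1..?p}. block ((?ms @ [?m]) ! (i - 1)) (int t - int (Suc ?p - i))) + block ?m (int t)"
      by (simp add: nth_append)
    also have "(\<Sum>i\<in>{1..?p}. block ((?ms @ [?m]) ! (i - 1)) (int t - int (Suc ?p - i)))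
      = (\<Sum>i\<in>{1..?p}. block (?ms ! (i - 1)) (int t - 1 - int (?p - i)))"
      using shift by (rule sum.cong[OF refl])
    \<comment> \<open>At \<open>t = 0\<close> the older blocks are evaluated at negative
      arguments.\<close>
    also have "\<dots> = (if t = 0 then 0 else dhilb ?I (t - 1))"
      using IH by (auto simp: block_def of_nat_diff intro!: sum.neutral)
    finally show ?thesis using dh by simp
  qed
  then show ?case
    using \<open>obtained_by_bdl ?J\<close> H(1) conf_ideal_snoc(2)[OF valid, where 'k = 'k] by (simp add: x)
qed

section \<open>Standard O-sequences\<close>

text \<open>Where an entry \<open>m\<close> is repeated, the piece attached to the second copy is the sum of the
  blocks of both copies.\<close>

lemma std_O_seq_eq_sum_blocks:
  assumes sorted: "sorted ms" and pos: "\<And>m. m \<in> set ms \<Longrightarrow> 0 < m"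
    and twice: "\<And>i. i + 2 < length ms \<Longrightarrow> ms ! i < ms ! (i + 2)"
  shows "std_O_seq ms t = (\<Sum>i\<in>{1..length ms}. block (ms ! (i - 1)) (int t - int (length ms - i)))"
proof -
  let ?p = "length ms"
  let ?b = "\<lambda>i. block (ms ! (i - 1)) (int t - int (?p - i))"
  \<comment> \<open>The block of the first copy of a repeated entry is deferred to the next index;
    \<open>?rest q\<close> is what is still owed after \<open>q\<close> pieces. Since pieces count
    from 1, \<open>ms ! (q - 1)\<close> and \<open>ms ! q\<close> are entries \<open>q\<close> and
    \<open>q + 1\<close>.\<close>
  let ?rest = "\<lambda>q. if 0 < q \<and> q < ?p \<and> ms ! (q - 1) = ms ! q then ?b q else 0"
  have "(\<Sum>i\<in>{1..q}. std_piece ms i (int t - int (?p - i))) = (\<Sum>i\<in>{1..q}. ?b i) - ?rest q" if "q \<le> ?p" for q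
    using that
  proof (induction q)
    case (Suc q)
    have IH: "(\<Sum>i\<in>{1..q}. std_piece ms i (int t - int (?p - i))) = (\<Sum>i\<in>{1..q}. ?b i) - ?rest q"
      using Suc by simp
    have q: "0 < ms ! q" using pos[of "ms ! q"] Suc.prems by simp
    have next_le: "ms ! q \<le> ms ! Suc q" if "Suc q < ?p" using sorted_nth_mono[OF sorted, of q "Suc q"] that by simp
    have prev_le: "ms ! (q - 1) \<le> ms ! q" using sorted_nth_mono[OF sorted, of "q - 1" q] Suc.prems by simp
    have tw: "ms ! (q - 1) < ms ! Suc q" if "0 < q" "Suc q < ?p" using twice[of "q - 1"] that by simp
    \<comment> \<open>Relative to the second copy the two blocks occupy degrees
      \<open>0..m-1\<close> and \<open>1..m\<close>, with sum 1, 2, ..., 2, 1.\<close>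
    have "std_piece ms (Suc q) (int t - int (?p - Suc q)) + ?rest (Suc q) = ?b (Suc q) + ?rest q"
      using Suc.prems q next_le prev_le tw
      by (cases q) (auto simp: std_piece_def block_def Let_def of_nat_diff)
    then show ?case using IH by simp
  qed simp
  from this[of ?p] show ?thesis by (simp add: std_O_seq_def)
qed

section \<open>Sorted values of the rows\<close>

lemma sorted_last_eqI:
  fixes x :: "'a::linorder"
  assumes "sorted xs" "x \<in> set xs" "\<And>y. y \<in> set xs \<Longrightarrow> y \<le> x"
  shows "last xs = x"
  using assms by (cases xs rule: rev_cases) (force simp: sorted_append)+

text \<open>A value arises from at most one simple and one double row, so three positions of equal
  value would repeat a row.\<close>

lemma valid_rows_lt_nth:
  assumes valid: "valid_rows N ps" and i: "i + 2 < length ps"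
  shows "map (\<lambda>(e, n). e * n) ps ! i < map (\<lambda>(e, n). e * n) ps ! (i + 2)"
proof (rule ccontr)
  let ?v = "\<lambda>(e, n). e * n :: nat"
  let ?ms = "map ?v ps"
  assume "\<not> ?ms ! i < ?ms ! (i + 2)"
  moreover have "?ms ! i \<le> ?ms ! (i + 1)" "?ms ! (i + 1) \<le> ?ms ! (i + 2)"
    using valid i by (auto simp only: valid_rows_def intro!: sorted_nth_mono) auto
  ultimately have eq: "?v (ps ! i) = ?v (ps ! (i + 1))" "?v (ps ! i) = ?v (ps ! (i + 2))"
    using i by auto
  obtain e n e' n' e'' n'' where ps: "ps ! i = (e, n)" "ps ! (i + 1) = (e', n')" "ps ! (i + 2) = (e'', n'')"
    by (metis surj_pair)
  have "(e, n) \<in> set ps" "(e', n') \<in> set ps" "(e'', n'') \<in> set ps"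
    using i ps by (metis add_lessD1 nth_mem less_trans lessI add_2_eq_Suc' Suc_eq_plus1)+
  then have "e = 1 \<or> e = 2" "e' = 1 \<or> e' = 2" "e'' = 1 \<or> e'' = 2"
    using valid_rowsD(1)[OF valid] by blast+
  then have "ps ! i = ps ! (i + 1) \<or> ps ! i = ps ! (i + 2) \<or> ps ! (i + 1) = ps ! (i + 2)"
    using eq unfolding ps by auto
  moreover have "distinct ps" using valid by (simp add: valid_rows_def)
  ultimately show False using i by (auto simp: nth_eq_iff_index_eq)
qed

text \<open>Rows from \<open>i\<close> on have at least the value of row \<open>i\<close>, and few
  pairs with \<open>n \<le> N\<close> do. Hence the shifted block of row \<open>i\<close> ends
  before degree \<open>2 * N\<close>, which bounds the regularity from above.\<close>

lemma valid_rows_count_bound: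
  assumes valid: "valid_rows N ps" and i: "i < length ps"
  shows "map (\<lambda>(e, n). e * n) ps ! i + (length ps - Suc i) \<le> 2 * N"
proof -
  let ?v = "\<lambda>(e, n). e * n :: nat"
  define v where "v = map ?v ps ! i"
  \<comment> \<open>The candidates for simple and double rows of value at least \<open>v\<close>;
    the second lower bound is \<open>v / 2\<close> rounded up.\<close>
  let ?S = "Pair 1 ` {v..N} \<union> Pair 2 ` {(v + 1) div 2..N} :: (nat \<times> nat) set"
  obtain e n where en: "ps ! i = (e, n)" by fastforce
  then have "(e, n) \<in> set ps" using i by (metis nth_mem)
  then have "e = 1 \<or> e = 2" "0 < n" "n \<le> N" using valid_rowsD[OF valid] by blast+
  then have v: "0 < v" "v \<le> 2 * N" using en i by (auto simp: v_def)
  have "set (drop i ps) \<subseteq> ?S"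
  proof
    fix x assume x: "x \<in> set (drop i ps)"
    then obtain k where k: "k < length ps" "i \<le> k" "x = ps ! k"
      by (metis add.commute in_set_conv_nth le_add1 length_drop less_diff_conv nth_drop i less_imp_le)
    obtain e n where en: "x = (e, n)" by fastforce
    have "v \<le> map ?v ps ! k"
      unfolding v_def using valid k by (intro sorted_nth_mono) (auto simp: valid_rows_def)
    then have "v \<le> e * n" using k(1) k(3)[symmetric] en by simp
    moreover have "(e, n) \<in> set ps" using x en by (metis in_set_dropD)
    then have "e = 1 \<or> e = 2" "n \<le> N" using valid_rowsD[OF valid] by blast+
    ultimately show "x \<in> ?S" unfolding en by auto
  qed
  then have "card (set (drop i ps)) \<le> card ?S" by (intro card_mono) auto
  also have "\<dots> \<le> card (Pair (1::nat) ` {v..N}) + card (Pair (2::nat) ` {(v + 1) div 2..N})"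
    by (rule card_Un_le)
  also have "\<dots> = (Suc N - v) + (Suc N - (v + 1) div 2)"
    by (simp add: card_image inj_on_def)
  finally have "length ps - i \<le> (Suc N - v) + (Suc N - (v + 1) div 2)"
    using valid by (simp add: valid_rows_def distinct_card)
  then show ?thesis using v i unfolding v_def[symmetric] by linarith
qed

section \<open>The first infinitesimal neighborhood of the spread out configuration\<close>

theorem theorem5p4:
  fixes T :: "nat list"
  assumes "two_type_vector T"
  defines "Z \<equiv> first_inf_nbhd_ideal (spread_out_config T :: ('k::field_char_0 \<times> 'k \<times> 'k) set)"
  shows "obtained_by_bdl Z
       \<and> (\<forall>t. dhilb Z t = std_O_seq (pseudo_type_vector T) t)
       \<and> regularity Z = last (pseudo_type_vector T)
       \<and> last (pseudo_type_vector T) = 2 * last T"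
proof -
  define N where "N = last T"
  let ?v = "\<lambda>(e, n). e * n :: nat"
  \<comment> \<open>Each row occurs with multiplicities 1 and 2, so the values \<open>e * n\<close>
    are the entries of the pseudo type vector.\<close>
  define ps where "ps = sort_key ?v (map (Pair 1) T @ map (Pair 2) T)"
  define ms where "ms = map ?v ps"
  have T: "T \<noteq> []" "sorted_wrt (<) T" "\<And>n. n \<in> set T \<Longrightarrow> 0 < n"
    using assms(1) by (auto simp: two_type_vector_def)
  have N: "N \<in> set T" "\<And>n. n \<in> set T \<Longrightarrow> n \<le> N"
  proof -
    show "N \<in> set T" using T by (simp add: N_def)
    have "sorted T" using T(2) by (simp add: strict_sorted_imp_sorted)
    then show "n \<le> N" if "n \<in> set T" for n
      using that T(1) unfolding N_def by (cases T rule: rev_cases) (auto simp: sorted_append)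
  qed
  have "distinct T" using T(2) by (simp add: strict_sorted_iff)
  have set_ps: "set ps = Pair 1 ` set T \<union> Pair 2 ` set T"
    by (simp add: ps_def)
  have valid: "valid_rows N ps"
    unfolding valid_rows_def set_ps using \<open>distinct T\<close> N T(3)
    by (auto simp: ps_def distinct_map inj_on_def)
  have ms: "pseudo_type_vector T = ms"
    unfolding pseudo_type_vector_def
    by (rule properties_for_sort) (auto simp: ms_def ps_def multiset.map_comp comp_def)
  have "length ms = length ps" by (simp add: ms_def)
  have Z: "Z = conf_ideal N ps"
  proof -
    have "Z = (\<Inter>n\<in>set T. \<Inter>j<n. dbl_ideal (of_nat j) (of_nat (N - n)))"
      unfolding Z_def first_inf_nbhd_ideal_def spread_out_config_def N_def
      by (auto simp: point_ideal_eq ideal_prod_pt_ideal) (metis point_ideal_eq ideal_prod_pt_ideal)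
    \<comment> \<open>The conditions of the simple rows follow from those of the double
      rows.\<close>
    also have "\<dots> = conf_ideal N ps"
      unfolding conf_ideal_def set_ps mult_ideal_def using dbl_ideal_subset_pt_ideal by fastforce
    finally show ?thesis .
  qed
  let ?b = "\<lambda>t i. block (ms ! (i - 1)) (int t - int (length ms - i))"
  have main: "obtained_by_bdl Z" "\<And>t. dhilb Z t = (\<Sum>i\<in>{1..length ms}. ?b t i)"
    using conf_ideal_bdl_and_dhilb[OF valid, where 'k = 'k] by (simp_all add: Z ms_def)
  have sorted: "sorted ms" using valid by (simp add: valid_rows_def ms_def)
  have "std_O_seq ms t = (\<Sum>i\<in>{1..length ms}. ?b t i)" for t
  proof (rule std_O_seq_eq_sum_blocks[OF sorted])
    show "0 < m" if "m \<in> set ms" for m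
      using that T(3) by (auto simp: ms_def set_ps)
    show "ms ! i < ms ! (i + 2)" if "i + 2 < length ms" for i
      unfolding ms_def using that by (intro valid_rows_lt_nth[OF valid]) (simp add: ms_def)
  qed
  then have dh: "dhilb Z t = std_O_seq ms t" for t using main(2) by simp
  have last: "last ms = 2 * N"
    using N by (intro sorted_last_eqI[OF sorted]) (force simp: ms_def set_ps)+
  have "ms \<noteq> []" using N(1) set_ps by (auto simp: ms_def)
  have "regularity Z = 2 * N"
    unfolding regularity_def
  proof (rule Least_equality)
    have "?b (2 * N) i = 0" if i: "i \<in> {1..length ms}" for i
    proof -
      have "i - 1 < length ps" using i \<open>length ms = length ps\<close> by auto
      from valid_rows_count_bound[OF valid this] have "ms ! (i - 1) + (length ms - i) \<le> 2 * N"
        using i by (simp add: ms_def)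
      then show ?thesis by (auto simp: block_def)
    qed
    then show "dhilb Z (2 * N) = 0" by (simp add: main(2))
  next
    fix t assume t: "dhilb Z t = 0"
    show "2 * N \<le> t"
    proof (rule ccontr)
      assume "\<not> 2 * N \<le> t"
      \<comment> \<open>The last block is unshifted and has length \<open>2 * N\<close>; as all
        blocks are nonnegative, the difference is positive below \<open>2 * N\<close>.\<close>
      then have "?b t (length ms) = 1"
        using last \<open>ms \<noteq> []\<close> by (simp add: block_def last_conv_nth)
      moreover have "?b t (length ms) \<le> (\<Sum>i\<in>{1..length ms}. ?b t i)"
        using \<open>ms \<noteq> []\<close> by (intro member_le_sum) (auto simp: block_def Suc_le_eq)
      ultimately show False using t main(2)[of t] by simp
    qed
  qed
  then show ?thesis
    using main(1) dh last by (simp add: ms N_def)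
qed

end
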